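(* For the Erdős measure $\mu$ the pointwise dimension exists and $$\dim(\mu)=H_\mu,$$ i.e. for $\mu$-a.e. $x\in[0,1]$, $\displaystyle\lim_{r\to0}\frac{\log\mu(B(x,r))}{\log r}=H_\mu$.
   Context: $\lambda=\frac{1+\sqrt5}{2}$. The Erdős measure $\mu$ on $[0,1]$ is the distribution of $\sum_{k=1}^\infty\varepsilon_k\lambda^{-k-1}$, where the $\varepsilon_k$ are independent and equal to 0 or 1 with probability $\frac12$ each. $B(x,r)$ is the ball of radius $r$ centred at $x$. A Borel probability measure $\nu$ on a metric space has pointwise dimension $\dim(\nu)=\alpha$ if $\lim_{r\to0}\frac{\log\nu(B(x,r))}{\log r}=\alpha$ for $\nu$-a.e. $x$. Garsia's entropy: let $H^{(n)}$ be the Shannon entropy $-\sum_wP(w)\log P(w)$ of the distribution of $\sum_{k=1}^n\varepsilon_k\lambda^{-k-1}$; then $H_\mu=\lim_{n\to\infty}\frac{H^{(n)}}{n\log\lambda}$ (the limit is known to exist). *)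

theory Defs
  imports "HOL-Probability.Probability"
begin

definition golden :: real where
  "golden = (1 + sqrt 5) / 2"

text \<open>Fair coin tossing. Sequences are indexed from 0, so the digit called
  \<open>\<epsilon>\<^sub>k\<close> (\<open>k \<ge> 1\<close>) is \<open>of_bool (\<omega> (k - 1))\<close>, and the weight \<open>\<lambda>\<^bsup>-k-1\<^esup>\<close> becomes
  \<open>1 / golden ^ (k + 2)\<close> below.\<close>

definition coin_space :: "(nat \<Rightarrow> bool) measure" where
  "coin_space = (\<Pi>\<^sub>M k\<in>UNIV. measure_pmf (bernoulli_pmf (1/2)))"

definition digit_term :: "nat \<Rightarrow> (nat \<Rightarrow> bool) \<Rightarrow> real" where
  "digit_term k \<omega> = of_bool (\<omega> k) / golden ^ (k + 2)"

definition partial_sum :: "nat \<Rightarrow> (nat \<Rightarrow> bool) \<Rightarrow> real" where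
  "partial_sum n \<omega> = (\<Sum>k<n. digit_term k \<omega>)"

text \<open>The Erdos measure, as a Borel measure on the line; it is concentrated on
  \<open>{0..1}\<close>, see \<open>emeasure_erdos_measure_unit_interval\<close>.\<close>

definition erdos_measure :: "real measure" where
  "erdos_measure = distr coin_space borel (\<lambda>\<omega>. \<Sum>k. digit_term k \<omega>)"

text \<open>Shannon entropy (in nats) of the distribution of a random variable taking
  finitely many values.\<close>

definition shannon_entropy :: "'a measure \<Rightarrow> ('a \<Rightarrow> 'b) \<Rightarrow> real" where
  "shannon_entropy M X =
     - (\<Sum>w \<in> X ` space M.
          let p = measure M {x \<in> space M. X x = w} in p * ln p)"

definition garsia_entropy :: real where
  "garsia_entropy =
     lim (\<lambda>n. shannon_entropy coin_space (partial_sum n) / (real n * ln golden))"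

text \<open>Pointwise dimension \<open>\<alpha>\<close> of a Borel probability measure. The positivity
  condition reflects \<open>log 0 = -\<infinity>\<close>: a point with a null ball around it has infinite
  local dimension, whereas \<open>ln 0 = 0\<close> in HOL would yield the limit 0.\<close>

definition has_pointwise_dimension :: "'a::metric_space measure \<Rightarrow> real \<Rightarrow> bool" where
  "has_pointwise_dimension \<nu> \<alpha> \<longleftrightarrow>
     prob_space \<nu> \<and> sets \<nu> = sets borel \<and>
     (AE x in \<nu>. (\<forall>r>0. measure \<nu> (ball x r) > 0) \<and>
        ((\<lambda>r. ln (measure \<nu> (ball x r)) / ln r) \<longlongrightarrow> \<alpha>) (at_right 0))"

text \<open>Well-definedness of the objects above.\<close>

lemma prob_space_coin_space: "prob_space coin_space"
  unfolding coin_space_def by (intro prob_space_PiM measure_pmf.prob_space_axioms)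

lemma space_coin_space [simp]: "space coin_space = UNIV"
  by (simp add: coin_space_def space_PiM)

lemma measurable_digit_term [measurable]: "digit_term k \<in> borel_measurable coin_space"
  unfolding digit_term_def coin_space_def by measurable

lemma measurable_partial_sum [measurable]: "partial_sum n \<in> borel_measurable coin_space"
  unfolding partial_sum_def by measurable

lemma finite_range_partial_sum: "finite (range (partial_sum n))"
proof (rule finite_subset)
  show "range (partial_sum n) \<subseteq>
      (\<lambda>A. \<Sum>k<n. of_bool (k \<in> A) / golden ^ (k + 2)) ` Pow {..<n}"
  proof safe
    fix \<omega> :: "nat \<Rightarrow> bool"
    show "partial_sum n \<omega> \<in> (\<lambda>A. \<Sum>k<n. of_bool (k \<in> A) / golden ^ (k + 2)) ` Pow {..<n}"
      by (rule image_eqI[of _ _ "{k. k < n \<and> \<omega> k}"])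
         (auto simp: partial_sum_def digit_term_def intro!: sum.cong)
  qed
qed auto

interpretation coin: information_space coin_space "exp 1"
  by (intro information_space.intro information_space_axioms.intro prob_space_coin_space) simp

lemma shannon_entropy_eq_entropy:
  assumes "simple_function coin_space X"
  shows "shannon_entropy coin_space X = coin.entropy_Pow X"
proof -
  have "coin.entropy_Pow X = - (\<Sum>w\<in>X ` space coin_space.
      measure coin_space (X -` {w} \<inter> space coin_space) *
      log (exp 1) (measure coin_space (X -` {w} \<inter> space coin_space)))"
    by (rule coin.entropy_simple_distributed[OF coin.simple_distributedI[OF assms measure_nonneg refl]])
  moreover have "X -` {w} = {x. X x = w}" for w
    by auto
  ultimately show ?thesis
    by (simp add: shannon_entropy_def Let_def log_def)
qed

lemma simple_function_partial_sum: "simple_function coin_space (partial_sum n)"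
  by (rule simple_function_borel_measurable) (simp_all add: finite_range_partial_sum)

lemma golden_gt_1: "golden > 1"
proof -
  have "sqrt 5 > sqrt 1" by (subst real_sqrt_less_iff) simp
  then show ?thesis by (simp add: golden_def)
qed

lemma golden_squared: "golden ^ 2 = golden + 1"
  by (simp add: golden_def power2_eq_square field_simps)

lemma sums_golden: "(\<lambda>k. 1 / golden ^ (k + 2)) sums 1"
proof -
  have "(\<lambda>k. (1 / golden) ^ k) sums (1 / (1 - 1 / golden))"
    using golden_gt_1 by (intro geometric_sums) simp
  then have "(\<lambda>k. (1 / golden) ^ k / golden ^ 2) sums (1 / (1 - 1 / golden) / golden ^ 2)"
    by (rule sums_divide)
  moreover have "1 / (1 - 1 / golden) / golden ^ 2 = 1"
  proof -
    have "(1 - 1 / golden) * golden ^ 2 = golden ^ 2 - golden"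
      using golden_gt_1 by (simp add: algebra_simps power2_eq_square)
    then show ?thesis using golden_squared by simp
  qed
  moreover have "(1 / golden) ^ k / golden ^ 2 = 1 / golden ^ (k + 2)" for k
    by (simp only: power_divide power_add power_one divide_divide_eq_left)
  ultimately show ?thesis by (simp only:)
qed

lemma digit_term_bounds: "0 \<le> digit_term k \<omega>" "digit_term k \<omega> \<le> 1 / golden ^ (k + 2)"
  using golden_gt_1 by (auto simp: digit_term_def of_bool_def)

lemma summable_digit_term: "summable (\<lambda>k. digit_term k \<omega>)"
  by (rule summable_comparison_test'[OF sums_summable[OF sums_golden], of 0])
     (use digit_term_bounds in auto)

lemma suminf_digit_term_bounds: "(\<Sum>k. digit_term k \<omega>) \<in> {0..1}"
proof -
  have "(\<Sum>k. digit_term k \<omega>) \<le> (\<Sum>k. 1 / golden ^ (k + 2))"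
    by (intro suminf_le digit_term_bounds summable_digit_term sums_summable[OF sums_golden])
  then show ?thesis
    using sums_unique[OF sums_golden] suminf_nonneg[OF summable_digit_term digit_term_bounds(1)]
    by simp
qed

lemma sets_erdos_measure [simp]: "sets erdos_measure = sets borel"
  by (simp add: erdos_measure_def)

lemma prob_space_erdos_measure: "prob_space erdos_measure"
  unfolding erdos_measure_def
  by (rule prob_space.prob_space_distr[OF prob_space_coin_space]) measurable

lemma emeasure_erdos_measure_unit_interval: "emeasure erdos_measure {0..1} = 1"
proof -
  have "emeasure erdos_measure {0..1} =
      emeasure coin_space ((\<lambda>\<omega>. \<Sum>k. digit_term k \<omega>) -` {0..1} \<inter> space coin_space)"
    unfolding erdos_measure_def by (rule emeasure_distr) auto
  also have "(\<lambda>\<omega>. \<Sum>k. digit_term k \<omega>) -` {0..1} \<inter> space coin_space = space coin_space"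
    using suminf_digit_term_bounds by auto
  finally show ?thesis
    using prob_space.emeasure_space_1[OF prob_space_coin_space] by simp
qed

text \<open>Existence of the limit defining the entropy: \<open>n \<mapsto> H\<^sup>(\<^sup>n\<^sup>)\<close> is subadditive.\<close>

lemma coin_space_shift: "distr coin_space coin_space (\<lambda>\<omega> k. \<omega> (n + k)) = coin_space"
proof -
  have "distr (\<Pi>\<^sub>M k\<in>UNIV. measure_pmf (bernoulli_pmf (1/2)))
      (\<Pi>\<^sub>M k\<in>UNIV. measure_pmf (bernoulli_pmf (1/2))) (\<lambda>\<omega>. \<lambda>k\<in>UNIV. \<omega> (n + k)) =
      (\<Pi>\<^sub>M k\<in>UNIV. measure_pmf (bernoulli_pmf (1/2)))"
    by (rule distr_PiM_reindex) (auto simp: measure_pmf.prob_space_axioms)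
  then show ?thesis by (simp add: coin_space_def restrict_UNIV)
qed

lemma measurable_coin_shift [measurable]:
  "(\<lambda>\<omega> k. \<omega> (n + k)) \<in> coin_space \<rightarrow>\<^sub>M coin_space"
proof -
  have "(\<lambda>\<omega>. \<lambda>k\<in>UNIV. \<omega> (n + k)) \<in> coin_space \<rightarrow>\<^sub>M coin_space"
    unfolding coin_space_def by measurable
  then show ?thesis by (simp add: restrict_UNIV)
qed

lemma partial_sum_add:
  "partial_sum (n + m) \<omega> = partial_sum n \<omega> + partial_sum m (\<lambda>k. \<omega> (n + k)) / golden ^ n"
proof -
  have "partial_sum (n + m) \<omega> = partial_sum n \<omega> + (\<Sum>k<m. digit_term (n + k) \<omega>)"
    unfolding partial_sum_def by (induction m) auto
  moreover have "(\<Sum>k<m. digit_term (n + k) \<omega>) = partial_sum m (\<lambda>k. \<omega> (n + k)) / golden ^ n"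
    unfolding partial_sum_def sum_divide_distrib
    by (intro sum.cong) (auto simp: digit_term_def power_add)
  ultimately show ?thesis by simp
qed

lemma range_shift: "range (\<lambda>\<omega>. X (\<lambda>k. \<omega> (n + k :: nat))) = range X"
proof safe
  fix \<omega>
  show "X \<omega> \<in> range (\<lambda>\<omega>. X (\<lambda>k. \<omega> (n + k)))"
    by (rule range_eqI[of _ _ "\<lambda>k. \<omega> (k - n)"]) simp
qed auto

lemma shannon_entropy_partial_sum_subadditive:
  "shannon_entropy coin_space (partial_sum (n + m)) \<le>
     shannon_entropy coin_space (partial_sum n) + shannon_entropy coin_space (partial_sum m)"
proof -
  define T where "T = (\<lambda>\<omega>. partial_sum m (\<lambda>k. \<omega> (n + k)))"
  have T_meas: "T \<in> borel_measurable coin_space"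
    unfolding T_def by measurable
  have rT: "range T = range (partial_sum m)"
    unfolding T_def by (rule range_shift)
  have sf: "simple_function coin_space T"
    by (rule simple_function_borel_measurable)
       (use T_meas rT finite_range_partial_sum in auto)
  note sn = simple_function_partial_sum[of n]
  have "measure coin_space {\<omega>. T \<omega> = w} = measure coin_space {\<omega>. partial_sum m \<omega> = w}" for w
  proof -
    have "measure (distr coin_space coin_space (\<lambda>\<omega> k. \<omega> (n + k))) {\<omega> \<in> space coin_space. partial_sum m \<omega> = w} =
        measure coin_space ((\<lambda>\<omega> k. \<omega> (n + k)) -` {\<omega> \<in> space coin_space. partial_sum m \<omega> = w} \<inter> space coin_space)"
      by (rule measure_distr) measurable
    then show ?thesis by (simp add: coin_space_shift T_def vimage_def)
  qed
  then have hT: "shannon_entropy coin_space T = shannon_entropy coin_space (partial_sum m)"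
    by (simp add: shannon_entropy_def rT)
  have "partial_sum (n + m) = (\<lambda>(x, y). x + y / golden ^ n) \<circ> (\<lambda>\<omega>. (partial_sum n \<omega>, T \<omega>))"
    by (auto simp: partial_sum_add T_def)
  then have "coin.entropy_Pow (partial_sum (n + m)) \<le> coin.entropy_Pow (\<lambda>\<omega>. (partial_sum n \<omega>, T \<omega>))"
    by (simp only:) (rule coin.entropy_data_processing[OF simple_function_Pair[OF sn sf]])
  also have "\<dots> \<le> coin.entropy_Pow (partial_sum n) + coin.entropy_Pow T"
    using coin.entropy_chain_rule[OF sn sf] coin.conditional_entropy_less_eq_entropy[OF sf sn] by simp
  finally show ?thesis
    by (simp add: shannon_entropy_eq_entropy sf simple_function_partial_sum flip: hT)
qed

lemma shannon_entropy_nonneg: "shannon_entropy coin_space X \<ge> 0"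
proof -
  have "p * ln p \<le> 0" if "0 \<le> p" "p \<le> 1" for p :: real
    by (cases "p = 0") (use that in \<open>auto intro: mult_nonneg_nonpos\<close>)
  then show ?thesis
    by (simp add: shannon_entropy_def Let_def sum_nonpos coin.prob_le_1)
qed

lemma subadditive_convergent:
  fixes a :: "nat \<Rightarrow> real"
  assumes sub: "\<And>m n. a (m + n) \<le> a m + a n" and nonneg: "\<And>n. a n \<ge> 0"
  shows "convergent (\<lambda>n. a n / real n)"
proof -
  define L where "L = (INF n\<in>{1..}. a n / real n)"
  have bdd: "bdd_below ((\<lambda>n. a n / real n) ` {1..})"
    by (rule bdd_belowI[of _ 0]) (auto simp: nonneg)
  have lower: "L \<le> a n / real n" if "n \<ge> 1" for n
    unfolding L_def by (rule cINF_lower[OF bdd]) (use that in auto)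
  have mult: "a (q * m + r) \<le> real q * a m + a r" for q m r
  proof (induction q)
    case (Suc q)
    have "a (Suc q * m + r) = a (m + (q * m + r))" by (simp add: algebra_simps)
    also have "\<dots> \<le> a m + a (q * m + r)" by (rule sub)
    finally show ?case using Suc by (simp add: algebra_simps)
  qed simp
  have "(\<lambda>n. a n / real n) \<longlonglongrightarrow> L"
  proof (rule order_tendstoI)
    fix y assume "y < L"
    show "\<forall>\<^sub>F n in sequentially. y < a n / real n"
      by (rule eventually_sequentiallyI[of 1]) (rule less_le_trans[OF \<open>y < L\<close> lower])
  next
    fix y assume "L < y"
    then obtain m where m: "m \<ge> 1" "a m / real m < y"
      using cINF_less_iff[OF _ bdd, of y] by (auto simp: L_def)
    define C where "C = (\<Sum>r<m. a r)"
    have bound: "a n / real n \<le> a m / real m + C / real n" if "n \<ge> 1" for n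
    proof -
      have "a (n mod m) \<le> C"
        unfolding C_def by (rule member_le_sum) (use m nonneg in auto)
      moreover have "a n \<le> real (n div m) * a m + a (n mod m)"
        using mult[of "n div m" m "n mod m"] by simp
      moreover have "real (n div m) * a m \<le> real n / real m * a m"
        by (intro mult_right_mono nonneg of_nat_div_le_of_nat)
      ultimately have "a n \<le> real n / real m * a m + C" by linarith
      then have "a n / real n \<le> (real n / real m * a m + C) / real n"
        by (rule divide_right_mono) simp
      also have "\<dots> = a m / real m + C / real n"
        using that by (simp add: add_divide_distrib)
      finally show ?thesis .
    qed
    have "(\<lambda>n. a m / real m + C / real n) \<longlonglongrightarrow> a m / real m + 0"
      by (intro tendsto_intros lim_const_over_n)
    then have "\<forall>\<^sub>F n in sequentially. a m / real m + C / real n < y"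
      using m by (intro order_tendstoD) auto
    then show "\<forall>\<^sub>F n in sequentially. a n / real n < y"
      using eventually_ge_at_top[of 1] by eventually_elim (use bound in force)
  qed
  then show ?thesis by (rule convergentI)
qed

lemma garsia_entropy_limit:
  "(\<lambda>n. shannon_entropy coin_space (partial_sum n) / (real n * ln golden)) \<longlonglongrightarrow> garsia_entropy"
proof -
  have "convergent (\<lambda>n. shannon_entropy coin_space (partial_sum n) / real n)"
    by (intro subadditive_convergent shannon_entropy_partial_sum_subadditive shannon_entropy_nonneg)
  then have "convergent (\<lambda>n. shannon_entropy coin_space (partial_sum n) / real n * (1 / ln golden))"
    by (intro convergent_mult convergent_const)
  then show ?thesis
    unfolding garsia_entropy_def convergent_LIMSEQ_iff by simp
qed

end

theory Submission
  imports Defs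
begin

text \<open>
  Let \<open>P n w\<close> be the probability that the \<open>n\<close>-th partial sum \<open>S n\<close> equals \<open>w\<close>. Concatenating
  digit strings shows that the information \<open>- ln (P n (S n \<omega>))\<close> is a subadditive cocycle over the
  Bernoulli shift, so by Kingman's theorem it grows almost surely like \<open>n h\<close>, where
  \<open>h = lim H\<^sup>(\<^sup>n\<^sup>) / n\<close>. Since the limit \<open>x\<close> of \<open>S n \<omega>\<close> lies within \<open>golden ^ (- n)\<close> of it, the ball
  of that radius around \<open>x\<close> has mass about at least \<open>P n (S n \<omega>)\<close>; conversely, because \<open>golden\<close> is a
  Pisot number, distinct values of \<open>S n\<close> are separated on the scale \<open>golden ^ (- n)\<close>, so the mass is
  at most the sum of \<open>P n\<close> over boundedly many neighbours of \<open>S n \<omega>\<close>. A counting argument and the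
  Borel-Cantelli lemma show that almost surely none of these neighbours eventually carries
  exponentially more mass than \<open>exp (- n h)\<close>.
\<close>

subsection \<open>The Bernoulli shift\<close>

definition lshift :: "nat \<Rightarrow> (nat \<Rightarrow> bool) \<Rightarrow> nat \<Rightarrow> bool" where
  "lshift n \<omega> = (\<lambda>k. \<omega> (n + k))"

lemma lshift_0 [simp]: "lshift 0 \<omega> = \<omega>"
  by (simp add: lshift_def)

lemma lshift_lshift [simp]: "lshift m (lshift n \<omega>) = lshift (n + m) \<omega>"
  by (simp add: lshift_def add.assoc)

lemma measurable_lshift [measurable]: "lshift n \<in> coin_space \<rightarrow>\<^sub>M coin_space"
  using measurable_coin_shift[of n] by (simp add: lshift_def[abs_def])

lemma distr_lshift: "distr coin_space coin_space (lshift n) = coin_space"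
  using coin_space_shift[of n] by (simp add: lshift_def[abs_def])

lemma prob_lshift:
  assumes [measurable]: "A \<in> sets coin_space"
  shows "coin.prob (lshift n -` A) = coin.prob A"
proof -
  have "coin.prob A = measure (distr coin_space coin_space (lshift n)) A"
    by (simp add: distr_lshift)
  also have "\<dots> = coin.prob (lshift n -` A)"
    by (subst measure_distr) auto
  finally show ?thesis by simp
qed

lemma expectation_lshift:
  fixes g :: "(nat \<Rightarrow> bool) \<Rightarrow> real"
  assumes [measurable]: "g \<in> borel_measurable coin_space"
  shows "coin.expectation (\<lambda>\<omega>. g (lshift n \<omega>)) = coin.expectation g"
proof -
  have "coin.expectation g = (\<integral>\<omega>. g \<omega> \<partial>distr coin_space coin_space (lshift n))"
    by (simp add: distr_lshift)
  also have "\<dots> = coin.expectation (\<lambda>\<omega>. g (lshift n \<omega>))"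
    by (rule integral_distr) auto
  finally show ?thesis by simp
qed

lemma measurable_coordinate: "(\<lambda>\<omega>. \<omega> k) \<in> coin_space \<rightarrow>\<^sub>M measure_pmf (bernoulli_pmf (1/2))"
  unfolding coin_space_def by measurable

lemma coordinates_indep:
  "coin.indep_vars (\<lambda>_. measure_pmf (bernoulli_pmf (1/2))) (\<lambda>k \<omega>. \<omega> k) UNIV"
proof (subst coin.indep_vars_iff_distr_eq_PiM)
  interpret product_prob_space "\<lambda>_. measure_pmf (bernoulli_pmf (1/2))" "UNIV :: nat set" ..
  have "distr coin_space (measure_pmf (bernoulli_pmf (1/2))) (\<lambda>\<omega>. \<omega> k) = measure_pmf (bernoulli_pmf (1/2))" for k
    unfolding coin_space_def by (rule PiM_component) auto
  then show "distr coin_space (\<Pi>\<^sub>M i\<in>UNIV. measure_pmf (bernoulli_pmf (1/2))) (\<lambda>x. \<lambda>i\<in>UNIV. x i) =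
     (\<Pi>\<^sub>M i\<in>UNIV. distr coin_space (measure_pmf (bernoulli_pmf (1/2))) (\<lambda>\<omega>. \<omega> i))"
    by (simp add: restrict_UNIV flip: coin_space_def)
qed (use measurable_coordinate in simp_all)

text \<open>The first \<open>n\<close> digits are independent of the later ones.
  \<open>comb_seq n\<close> glues \<open>n\<close> digits of one sequence in front of another and
  carries the product measure to \<open>coin_space\<close>; under it the event becomes the rectangle
  \<open>A \<times> B\<close>.\<close>

lemma prob_prefix_Int_lshift:
  assumes A [measurable]: "A \<in> sets coin_space" and B [measurable]: "B \<in> sets coin_space"
    and prefix: "\<And>\<omega> \<omega>'. (\<And>k. k < n \<Longrightarrow> \<omega> k = \<omega>' k) \<Longrightarrow> \<omega> \<in> A \<longleftrightarrow> \<omega>' \<in> A"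
  shows "coin.prob (A \<inter> lshift n -` B) = coin.prob A * coin.prob B"
proof -
  interpret sequence_space "measure_pmf (bernoulli_pmf (1/2))" ..
  let ?c = "\<lambda>(\<omega>, \<omega>'). comb_seq n \<omega> \<omega>'"
  have S: "coin_space = S" by (simp add: coin_space_def)
  have m: "?c \<in> coin_space \<Otimes>\<^sub>M coin_space \<rightarrow>\<^sub>M coin_space"
    unfolding S by (rule measurable_comb_seq)
  have [measurable]: "lshift n -` B \<in> sets coin_space"
    using measurable_sets[OF measurable_lshift B] by simp
  have "emeasure coin_space (A \<inter> lshift n -` B) =
      emeasure (distr (coin_space \<Otimes>\<^sub>M coin_space) coin_space ?c) (A \<inter> lshift n -` B)"
    unfolding S PiM_comb_seq ..
  also have "\<dots> = emeasure (coin_space \<Otimes>\<^sub>M coin_space) (?c -` (A \<inter> lshift n -` B) \<inter> space (coin_space \<Otimes>\<^sub>M coin_space))"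
    by (rule emeasure_distr[OF m]) measurable
  also have "?c -` (A \<inter> lshift n -` B) \<inter> space (coin_space \<Otimes>\<^sub>M coin_space) = A \<times> B"
  proof -
    have "comb_seq n \<omega> \<omega>' \<in> A \<longleftrightarrow> \<omega> \<in> A" for \<omega> \<omega>'
      by (rule prefix) (simp add: comb_seq_less)
    moreover have "lshift n (comb_seq n \<omega> \<omega>') = \<omega>'" for \<omega> \<omega>'
      by (auto simp: lshift_def comb_seq_def)
    ultimately show ?thesis by (auto simp: space_pair_measure)
  qed
  also have "emeasure (coin_space \<Otimes>\<^sub>M coin_space) (A \<times> B) = emeasure coin_space A * emeasure coin_space B"
    by (rule coin.emeasure_pair_measure_Times) measurable
  finally show ?thesis
    by (simp add: measure_def enn2real_mult)
qed

text \<open>The preimages of \<open>A\<close> under the iterated shifts decrease, and all have the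
  probability of \<open>A\<close>. Their intersection therefore has that probability too, and being
  a tail event it falls under Kolmogorov's zero-one law.\<close>

lemma invariant_zero_one:
  assumes A: "A \<in> sets coin_space" and sub: "lshift 1 -` A \<subseteq> A"
  shows "coin.prob A = 0 \<or> coin.prob A = 1"
proof -
  have sA [measurable]: "lshift n -` A \<in> sets coin_space" for n
    using measurable_sets[OF measurable_lshift A] by simp
  have step: "lshift (Suc n) -` A \<subseteq> lshift n -` A" for n
    using sub by (auto simp: subset_iff dest!: spec[of _ "lshift n _"])
  have dec: "decseq (\<lambda>n. lshift n -` A)"
    by (rule decseq_SucI) (rule step)
  define B where "B = (\<Inter>n. lshift n -` A)"
  let ?M = "measure_pmf (bernoulli_pmf (1/2))"
  define F where "F = (\<lambda>k. {(\<lambda>\<omega>. \<omega> k) -` X \<inter> space coin_space |X. X \<in> sets ?M})"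
  define G where "G = (\<lambda>n. sigma_sets (space coin_space) (\<Union>k\<in>{n..}. sigma_sets (space coin_space) (F k)))"
  have "(\<lambda>n. coin.prob (lshift n -` A)) \<longlonglongrightarrow> coin.prob B"
    unfolding B_def by (rule coin.finite_Lim_measure_decseq[OF _ dec]) auto
  then have pB: "coin.prob B = coin.prob A"
    by (simp add: prob_lshift[OF A] LIMSEQ_const_iff)
  have tail: "lshift n -` A \<in> G n" for n
  proof -
    let ?S = "sigma UNIV (\<Union>k\<in>{n..}. sigma_sets (space coin_space) (F k))"
    have "lshift n \<in> ?S \<rightarrow>\<^sub>M (\<Pi>\<^sub>M k\<in>UNIV. ?M)"
    proof (rule measurable_PiM_single')
      fix i
      show "(\<lambda>\<omega>. lshift n \<omega> i) \<in> ?S \<rightarrow>\<^sub>M ?M"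
      proof (rule measurableI)
        fix X assume "X \<in> sets ?M"
        then have "(\<lambda>\<omega>. lshift n \<omega> i) -` X \<in> F (n + i)"
          by (auto simp: F_def lshift_def)
        then show "(\<lambda>\<omega>. lshift n \<omega> i) -` X \<inter> space ?S \<in> sets ?S"
          by (auto intro!: sigma_sets.Basic bexI[of _ "n + i"])
      qed auto
    qed auto
    from measurable_sets[OF this A[unfolded coin_space_def]] show ?thesis
      by (simp add: G_def)
  qed
  have "B \<in> coin.tail_events (\<lambda>k. sigma_sets (space coin_space) (F k))"
  proof -
    have "B \<in> G n" for n
    proof -
      interpret G: sigma_algebra "space coin_space" "G n"
        unfolding G_def by (rule sigma_algebra_sigma_sets) auto
      have "lshift m -` A \<in> G n" if "m \<ge> n" for m
      proof -
        have "G m \<subseteq> G n"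
          unfolding G_def by (rule sigma_sets_mono') (use that in force)
        then show ?thesis using tail[of m] by auto
      qed
      then have "(\<Inter>m\<in>{n..}. lshift m -` A) \<in> G n"
        by (intro G.countable_INT) auto
      \<comment> \<open>Dropping the first \<open>n\<close> members of a decreasing family does not
        change its intersection; this puts \<open>B\<close> in the sigma-algebra of the digits from
        \<open>n\<close> on, for every \<open>n\<close>.\<close>
      also have "(\<Inter>m\<in>{n..}. lshift m -` A) = B"
      proof -
        have "x \<in> lshift m -` A" if "\<forall>m\<ge>n. x \<in> lshift m -` A" for x m
          using that[rule_format, of "max m n"] decseqD[OF dec, of m "max m n"] by auto
        then show ?thesis by (auto simp: B_def)
      qed
      finally show ?thesis .
    qed
    then show ?thesis by (simp add: coin.tail_events_def G_def)
  qed
  moreover have "coin.indep_sets (\<lambda>k. sigma_sets (space coin_space) (F k)) UNIV"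
    using coordinates_indep by (simp add: coin.indep_vars_def F_def)
  ultimately have "coin.prob B = 0 \<or> coin.prob B = 1"
    by (intro coin.kolmogorov_0_1_law[of "\<lambda>k. sigma_sets (space coin_space) (F k)"]
        sigma_algebra_sigma_sets) (auto simp: F_def)
  then show ?thesis by (simp add: pB)
qed

subsection \<open>Kingman's theorem for bounded cocycles over the Bernoulli shift\<close>

text \<open>The condition \<open>prefix\<close> makes the values of \<open>f m\<close> on disjoint
  blocks of digits independent, so that in the upper bound Hoeffding's inequality can take the place
  of the pointwise ergodic theorem.\<close>

locale coin_subadditive =
  fixes f :: "nat \<Rightarrow> (nat \<Rightarrow> bool) \<Rightarrow> real" and C :: real
  assumes measurable_f [measurable]: "\<And>n. f n \<in> borel_measurable coin_space"
    and nonneg: "\<And>n \<omega>. 0 \<le> f n \<omega>"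
    and bound: "\<And>n \<omega>. f n \<omega> \<le> C * real n"
    and subadditive: "\<And>n m \<omega>. f (n + m) \<omega> \<le> f n \<omega> + f m (lshift n \<omega>)"
    and prefix: "\<And>n \<omega> \<omega>'. (\<And>k. k < n \<Longrightarrow> \<omega> k = \<omega>' k) \<Longrightarrow> f n \<omega> = f n \<omega>'"
begin

abbreviation h :: "nat \<Rightarrow> real" where
  "h n \<equiv> coin.expectation (f n)"

lemma C_nonneg: "0 \<le> C"
  using nonneg[of 1 undefined] bound[of 1 undefined] by simp

lemma integrable_f [simp]: "integrable coin_space (f n)"
  by (rule coin.integrable_const_bound[of _ "C * real n"]) (auto simp: nonneg bound)

section \<open>Lower growth bound by greedy coverings\<close>

lemma sum_lshift_split:
  fixes g :: "(nat \<Rightarrow> bool) \<Rightarrow> real"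
  shows "(\<Sum>k<n + m. g (lshift k \<omega>)) = (\<Sum>k<n. g (lshift k \<omega>)) + (\<Sum>k<m. g (lshift k (lshift n \<omega>)))"
  by (induction m) auto

text \<open>Cut the orbit segment from the left. At a point outside \<open>D\<close> remove a block
  of some length \<open>n \<le> N\<close> with \<open>f n\<close> below \<open>c n\<close>; at a
  point of \<open>D\<close> remove a single digit, at cost at most \<open>C\<close>. Once at most
  \<open>N\<close> digits remain, they cost at most \<open>C N\<close>.\<close>

lemma greedy_cover_bound:
  fixes c :: real and N :: nat
  defines "D \<equiv> {\<omega>. \<forall>n\<in>{1..N}. c * real n \<le> f n \<omega>}"
  assumes c: "0 \<le> c"
  shows "f M \<omega> \<le> c * real M + C * (\<Sum>k<M. indicator D (lshift k \<omega>)) + C * real N"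
proof (induction M arbitrary: \<omega> rule: less_induct)
  case (less M)
  have cover_nonneg: "0 \<le> C * (\<Sum>k<M. indicator D (lshift k \<omega>) :: real)"
    using C_nonneg by (intro mult_nonneg_nonneg sum_nonneg) auto
  show ?case
  proof (cases "M \<le> N")
    case True
    have "f M \<omega> \<le> C * real N"
      using bound[of M \<omega>] mult_left_mono[of "real M" "real N" C] True C_nonneg by simp
    then show ?thesis using c cover_nonneg by (smt (verit) mult_nonneg_nonneg of_nat_0_le_iff)
  next
    case False
    have step: ?thesis if n: "1 \<le> n" "n \<le> M"
      and fn: "f n \<omega> \<le> c * real n + C * (\<Sum>k<n. indicator D (lshift k \<omega>))" for n
    proof -
      obtain m where m: "M = n + m" using n(2) le_Suc_ex by blast
      have "f M \<omega> \<le> f n \<omega> + f m (lshift n \<omega>)"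
        unfolding m by (rule subadditive)
      also have "f m (lshift n \<omega>) \<le> c * real m + C * (\<Sum>k<m. indicator D (lshift k (lshift n \<omega>))) + C * real N"
        using n m by (intro less.IH) auto
      finally show ?thesis
        using fn unfolding m sum_lshift_split by (simp add: algebra_simps)
    qed
    show ?thesis
    proof (cases "\<omega> \<in> D")
      case True
      show ?thesis
        by (rule step[of 1]) (use False True bound[of 1 \<omega>] c in auto)
    next
      case nD: False
      then obtain n where n: "n \<in> {1..N}" "f n \<omega> < c * real n"
        by (auto simp: D_def not_le)
      have "0 \<le> C * (\<Sum>k<n. indicator D (lshift k \<omega>) :: real)"
        using C_nonneg by (intro mult_nonneg_nonneg sum_nonneg) auto
      with n False show ?thesis
        by (intro step[of n]) auto
    qed
  qed
qed

text \<open>Integration of the greedy bound: by shift invariance the expected number of visits to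
  \<open>D\<close> is \<open>M\<close> times its probability.\<close>

lemma expectation_le_greedy_cover:
  fixes c :: real and N :: nat
  defines "D \<equiv> {\<omega>. \<forall>n\<in>{1..N}. c * real n \<le> f n \<omega>}"
  assumes c: "0 \<le> c"
  shows "h M \<le> c * real M + C * (real M * coin.prob D) + C * real N"
proof -
  have "{\<omega> \<in> space coin_space. \<forall>n\<in>{1..N}. c * real n \<le> f n \<omega>} \<in> sets coin_space"
    by measurable
  then have [measurable]: "D \<in> sets coin_space" by (simp add: D_def)
  have [simp]: "integrable coin_space (\<lambda>\<omega>. indicator D (lshift k \<omega>) :: real)" for k
    by (rule coin.integrable_const_bound[of _ 1]) (auto simp: indicator_def)
  have "h M \<le> coin.expectation (\<lambda>\<omega>. c * real M + C * (\<Sum>k<M. indicator D (lshift k \<omega>)) + C * real N)"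
    by (intro integral_mono greedy_cover_bound[OF c, where N = N, folded D_def]) simp_all
  also have "\<dots> = c * real M + C * (\<Sum>k<M. coin.expectation (\<lambda>\<omega>. indicator D (lshift k \<omega>))) + C * real N"
    by (simp add: coin.prob_space[simplified])
  also have "(\<Sum>k<M. coin.expectation (\<lambda>\<omega>. indicator D (lshift k \<omega>))) = real M * coin.prob D"
    by (subst expectation_lshift) simp_all
  finally show ?thesis .
qed

text \<open>The argument of Katznelson and Weiss: if \<open>f n < c n\<close> infinitely often, then almost every
  orbit segment is covered greedily by blocks on which the average of \<open>f\<close> is below \<open>c\<close>.\<close>

lemma AE_eventually_lower:
  assumes L: "(\<lambda>n. h n / real n) \<longlonglongrightarrow> L" and c: "c < L"
  shows "AE \<omega> in coin_space. \<forall>k. \<forall>\<^sub>F n in sequentially. (c - 1 / Suc k) * real n \<le> f n \<omega>"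
proof -
  \<comment> \<open>The margin \<open>1 / Suc k\<close> is existentially quantified so that
    \<open>A\<close> contains its preimage under the shift: prepending a digit changes the averages
    slightly, and passing from \<open>k\<close> to \<open>Suc k\<close> absorbs this.\<close>
  define A where "A = {\<omega>. \<exists>k. \<forall>N. \<exists>n\<ge>N. f n \<omega> < (c - 1 / Suc k) * real n}"
  have "{\<omega> \<in> space coin_space. \<exists>k. \<forall>N. \<exists>n. n \<ge> N \<and> f n \<omega> < (c - 1 / Suc k) * real n} \<in> sets coin_space"
    by measurable
  then have A: "A \<in> sets coin_space" by (simp add: A_def)
  have "lshift 1 -` A \<subseteq> A"
  proof
    fix \<omega> assume "\<omega> \<in> lshift 1 -` A"
    then obtain k where k: "\<And>N. \<exists>n\<ge>N. f n (lshift 1 \<omega>) < (c - 1 / Suc k) * real n"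
      by (auto simp: A_def)
    have "\<exists>n\<ge>N. f n \<omega> < (c - 1 / Suc (Suc k)) * real n" for N
    proof -
      define \<delta> :: real where "\<delta> = 1 / Suc k - 1 / Suc (Suc k)"
      have \<delta>: "\<delta> > 0" by (simp add: \<delta>_def frac_less2)
      \<comment> \<open>The gain \<open>n \<delta>\<close> from the larger index has to pay for the
        first digit, at most \<open>C\<close>, and for replacing \<open>n\<close> by
        \<open>Suc n\<close> in the bound, at most \<open>\<bar>c\<bar> + 1\<close>.\<close>
      obtain n0 :: nat where n0: "real n0 * \<delta> > C + \<bar>c\<bar> + 1"
        using ex_less_of_nat_mult[OF \<delta>] by blast
      obtain n where n: "n \<ge> max N n0" "f n (lshift 1 \<omega>) < (c - 1 / Suc k) * real n"
        using k by blast
      have "f (Suc n) \<omega> \<le> f 1 \<omega> + f n (lshift 1 \<omega>)"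
        using subadditive[of 1 n \<omega>] by simp
      also have "\<dots> < C + (c - 1 / Suc k) * real n"
        using n(2) bound[of 1 \<omega>] by simp
      also have "\<dots> = C + (c - 1 / Suc (Suc k)) * real (Suc n) - c + 1 / Suc (Suc k) - real n * \<delta>"
        by (simp add: \<delta>_def algebra_simps add_divide_distrib)
      also have "\<dots> \<le> (c - 1 / Suc (Suc k)) * real (Suc n)"
      proof -
        have "real n0 * \<delta> \<le> real n * \<delta>" using n(1) \<delta> by (intro mult_right_mono) auto
        moreover have "1 / real (Suc (Suc k)) \<le> 1" by simp
        ultimately show ?thesis using n0 abs_ge_minus_self[of c] by linarith
      qed
      finally show ?thesis using n(1) by (intro exI[of _ "Suc n"]) auto
    qed
    then show "\<omega> \<in> A" unfolding A_def mem_Collect_eq by blast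
  qed
  then have "coin.prob A = 0 \<or> coin.prob A = 1"
    by (rule invariant_zero_one[OF A])
  moreover have "coin.prob A \<noteq> 1"
  proof
    assume A1: "coin.prob A = 1"
    have lt: "\<exists>n\<ge>1. f n \<omega> < c * real n" if A\<omega>: "\<omega> \<in> A" for \<omega>
    proof -
      obtain k n where n: "n \<ge> 1" "f n \<omega> < (c - 1 / Suc k) * real n"
        using A\<omega> unfolding A_def by blast
      have "(c - 1 / Suc k) * real n \<le> c * real n" by (intro mult_right_mono) auto
      with n show ?thesis by (blast intro: less_le_trans)
    qed
    have c0: "0 \<le> c"
    proof -
      have "A \<noteq> {}" using A1 by auto
      then obtain \<omega> n where "n \<ge> 1" "f n \<omega> < c * real n" using lt by blast
      then have "0 < c * real n" using nonneg[of n \<omega>] by linarith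
      with \<open>n \<ge> 1\<close> show ?thesis by (simp add: zero_less_mult_iff)
    qed
    \<comment> \<open>If \<open>A\<close> had full measure, almost every point would have a block
      with average below \<open>c\<close>, so the sets \<open>D N\<close> would decrease to a null
      set.\<close>
    define D where "D = (\<lambda>N. {\<omega>. \<forall>n\<in>{1..N::nat}. c * real n \<le> f n \<omega>})"
    have "{\<omega> \<in> space coin_space. \<forall>n\<in>{1..N::nat}. c * real n \<le> f n \<omega>} \<in> sets coin_space" for N
      by measurable
    then have D [measurable]: "D N \<in> sets coin_space" for N by (simp add: D_def)
    have "decseq D"
      by (rule decseq_SucI) (auto simp: D_def)
    then have lim: "(\<lambda>N. coin.prob (D N)) \<longlonglongrightarrow> coin.prob (\<Inter>N. D N)"
      by (intro coin.finite_Lim_measure_decseq) auto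
    have "(\<Inter>N. D N) \<subseteq> space coin_space - A"
    proof
      fix \<omega> assume "\<omega> \<in> (\<Inter>N. D N)"
      then have "c * real n \<le> f n \<omega>" if "n \<ge> 1" for n
        using that unfolding D_def by fastforce
      then show "\<omega> \<in> space coin_space - A" using lt by (force simp: not_less)
    qed
    then have "coin.prob (\<Inter>N. D N) \<le> coin.prob (space coin_space - A)"
      by (rule coin.finite_measure_mono) (rule sets.compl_sets[OF A])
    also have "\<dots> = 0" using A1 A by (subst coin.prob_compl) auto
    finally have "coin.prob (\<Inter>N. D N) = 0" by (simp add: measure_le_0_iff)
    with lim have limD: "(\<lambda>N. coin.prob (D N)) \<longlonglongrightarrow> 0" by simp
    \<comment> \<open>First \<open>M\<close> tends to infinity with \<open>N\<close> fixed, which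
      removes the boundary cost \<open>C N / M\<close>; afterwards \<open>N\<close> does, which
      removes the probability of \<open>D N\<close> and contradicts \<open>c < L\<close>.\<close>
    have "L \<le> c + C * coin.prob (D N)" for N
    proof (rule LIMSEQ_le[OF L])
      show "(\<lambda>M. c + C * coin.prob (D N) + C * real N / real M) \<longlonglongrightarrow> c + C * coin.prob (D N)"
        using tendsto_add[OF tendsto_const lim_const_over_n[of "C * real N"]] by simp
      show "\<exists>M0. \<forall>M\<ge>M0. h M / real M \<le> c + C * coin.prob (D N) + C * real N / real M"
      proof (intro exI allI impI)
        fix M :: nat assume "M \<ge> 1"
        then show "h M / real M \<le> c + C * coin.prob (D N) + C * real N / real M"
          using expectation_le_greedy_cover[OF c0, of M N]
          by (simp add: D_def field_simps)
      qed
    qed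
    moreover have "(\<lambda>N. c + C * coin.prob (D N)) \<longlonglongrightarrow> c + C * 0"
      by (intro tendsto_intros limD)
    ultimately have "L \<le> c + C * 0"
      by (intro LIMSEQ_le_const) auto
    with c show False by simp
  qed
  ultimately have "coin.prob A = 0" by simp
  then have "AE \<omega> in coin_space. \<omega> \<notin> A"
    using A by (intro AE_not_in) (simp add: coin.emeasure_eq_measure null_sets_def)
  then show ?thesis
    by eventually_elim (fastforce simp: A_def eventually_sequentially not_less)
qed

section \<open>Upper growth bound by independent blocks\<close>

lemma block_decomposition:
  "f (q * m + r) \<omega> \<le> (\<Sum>k<q. f m (lshift (k * m) \<omega>)) + C * real r"
proof (induction q arbitrary: \<omega>)
  case 0
  then show ?case using bound[of r \<omega>] by simp
next
  case (Suc q)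
  have "f (Suc q * m + r) \<omega> \<le> f m \<omega> + f (q * m + r) (lshift m \<omega>)"
    using subadditive[of m "q * m + r" \<omega>] by (simp add: add.assoc)
  also have "f (q * m + r) (lshift m \<omega>) \<le> (\<Sum>k<q. f m (lshift (k * m) (lshift m \<omega>))) + C * real r"
    by (rule Suc.IH)
  finally show ?case
    by (subst sum.lessThan_Suc_shift) (simp add: add.commute)
qed

lemma blocks_indep:
  "coin.indep_vars (\<lambda>_. borel) (\<lambda>k \<omega>. f m (lshift (k * m) \<omega>)) UNIV"
proof -
  let ?M = "measure_pmf (bernoulli_pmf (1/2))"
  let ?K = "\<lambda>k. {k * m..<k * m + m}"
  \<comment> \<open>Positions outside the block are filled with the default \<open>False\<close>, so
    that \<open>g k\<close> depends on the coordinates in \<open>?K k\<close> alone; by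
    \<open>prefix\<close> it still agrees with the \<open>k\<close>-th block value.\<close>
  define g where "g = (\<lambda>k \<omega>. f m (\<lambda>i. if i < m then \<omega> (k * m + i) else False))"
  have disj: "disjoint_family_on ?K UNIV"
  unfolding disjoint_family_on_def
  proof (intro ballI impI)
    have "?K i \<inter> ?K j = {}" if "i < j" for i j
    proof -
      have "i * m + m \<le> j * m" using mult_le_mono1[of "Suc i" j m] that by simp
      then show ?thesis by auto
    qed
    then show "?K i \<inter> ?K j = {}" if "i \<noteq> j" for i j
      using that by (metis Int_commute linorder_neqE_nat)
  qed
  have "coin.indep_vars (\<lambda>k. PiM (?K k) (\<lambda>_. ?M)) (\<lambda>k \<omega>. restrict (\<lambda>i. \<omega> i) (?K k)) UNIV"
    by (rule coin.indep_vars_restrict[OF coordinates_indep _ disj]) simp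
  moreover have "g k \<in> borel_measurable (PiM (?K k) (\<lambda>_. ?M))" for k
    unfolding g_def
  proof (rule measurable_compose[OF _ measurable_f])
    show "(\<lambda>\<omega> i. if i < m then \<omega> (k * m + i) else False) \<in> PiM (?K k) (\<lambda>_. ?M) \<rightarrow>\<^sub>M coin_space"
      unfolding coin_space_def
    proof (rule measurable_PiM_single')
      fix i
      show "(\<lambda>\<omega>. if i < m then \<omega> (k * m + i) else False) \<in> PiM (?K k) (\<lambda>_. ?M) \<rightarrow>\<^sub>M ?M"
        by (cases "i < m") (auto intro!: measurable_component_singleton)
    qed auto
  qed
  ultimately have "coin.indep_vars (\<lambda>_. borel) (\<lambda>k \<omega>. g k (restrict (\<lambda>i. \<omega> i) (?K k))) UNIV"
    by (rule coin.indep_vars_compose2[where Y = g])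
  moreover have "g k (restrict (\<lambda>i. \<omega> i) (?K k)) = f m (lshift (k * m) \<omega>)" for k \<omega>
    unfolding g_def by (rule prefix) (simp add: lshift_def)
  ultimately show ?thesis by simp
qed

text \<open>Hoeffding's inequality gives a geometric bound for the exceptional sets, and the
  Borel-Cantelli lemma applies. A fixed slack of 1 per block suffices: divided by the block length
  \<open>m\<close> it becomes \<open>1 / m\<close>, and \<open>m\<close> is taken large at the
  end.\<close>

lemma AE_eventually_block_sum:
  "AE \<omega> in coin_space. \<forall>\<^sub>F q in sequentially. (\<Sum>k<q. f m (lshift (k * m) \<omega>)) < real q * (h m + 1)"
proof -
  \<comment> \<open>The added 1 keeps the range of the block values positive even when
    \<open>C * m\<close> is 0, so that Hoeffding's exponent has a nonzero denominator.\<close>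
  define b where "b = C * real m + 1"
  have b: "b \<ge> 1" using C_nonneg by (simp add: b_def)
  define E where "E = (\<lambda>q. {\<omega> \<in> space coin_space. (\<Sum>k<q. f m (lshift (k * m) \<omega>)) \<ge> real q * h m + real q})"
  have E [measurable]: "E q \<in> sets coin_space" for q
    unfolding E_def by measurable
  have le: "coin.prob (E q) \<le> exp (- 2 / b\<^sup>2) ^ q" for q
  proof (cases "q = 0")
    case False
    interpret H: Hoeffding_ineq coin_space "{..<q}" "\<lambda>k \<omega>. f m (lshift (k * m) \<omega>)"
      "\<lambda>_. 0" "\<lambda>_. b" "\<Sum>k<q. coin.expectation (\<lambda>\<omega>. f m (lshift (k * m) \<omega>))"
    proof unfold_locales
      show "coin.indep_vars (\<lambda>_. borel) (\<lambda>k \<omega>. f m (lshift (k * m) \<omega>)) {..<q}"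
        by (rule coin.indep_vars_subset[OF blocks_indep]) simp
    qed (use nonneg bound in \<open>auto simp: b_def add_increasing2\<close>)
    have "(\<Sum>k<q. coin.expectation (\<lambda>\<omega>. f m (lshift (k * m) \<omega>))) = real q * h m"
      by (subst expectation_lshift) auto
    moreover have "(\<Sum>k<q. (b - 0)\<^sup>2) > 0" using b False by (intro sum_pos) auto
    ultimately have "coin.prob (E q) \<le> exp (- 2 * (real q)\<^sup>2 / (\<Sum>k<q. (b - 0)\<^sup>2))"
      using H.Hoeffding_ineq_ge[of "real q"] by (simp add: E_def)
    also have "\<dots> = exp (real q * (- 2 / b\<^sup>2))"
      using False b by (simp add: power2_eq_square)
    also have "\<dots> = exp (- 2 / b\<^sup>2) ^ q" by (rule exp_of_nat_mult)
    finally show ?thesis .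
  qed simp
  have "summable (\<lambda>q. exp (- 2 / b\<^sup>2) ^ q)"
    using b by (intro summable_geometric) auto
  then have "summable (\<lambda>q. coin.prob (E q))"
    by (rule summable_comparison_test'[of _ 0]) (use le in auto)
  then have "AE \<omega> in coin_space. \<forall>\<^sub>F q in sequentially. \<omega> \<in> space coin_space - E q"
    by (intro borel_cantelli_AE1) (auto simp: coin.emeasure_eq_measure)
  then show ?thesis
    by eventually_elim (auto elim!: eventually_mono simp: E_def algebra_simps)
qed

lemma AE_eventually_upper:
  assumes m: "m \<ge> 1"
  shows "AE \<omega> in coin_space. \<forall>\<^sub>F n in sequentially. f n \<omega> \<le> (h m + 1) / real m * real n + C * real m"
  using AE_eventually_block_sum[of m]
proof eventually_elim
  case (elim \<omega>)
  have h0: "0 \<le> h m" by (simp add: nonneg)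
  have "filterlim (\<lambda>n. n div m) sequentially sequentially"
    using m by (intro filterlim_at_top_div_const_nat) auto
  from eventually_compose_filterlim[OF elim this] show ?case
  proof eventually_elim
    case (elim n)
    have "f n \<omega> \<le> (\<Sum>k<n div m. f m (lshift (k * m) \<omega>)) + C * real (n mod m)"
      using block_decomposition[of "n div m" m "n mod m" \<omega>] by simp
    also have "\<dots> \<le> real (n div m) * (h m + 1) + C * real m"
      using elim m C_nonneg by (intro add_mono mult_left_mono) auto
    also have "real (n div m) * (h m + 1) \<le> real n / real m * (h m + 1)"
      using h0 by (intro mult_right_mono of_nat_div_le_of_nat) auto
    finally show ?case by (simp add: mult.commute)
  qed
qed

theorem AE_tendsto:
  assumes L: "(\<lambda>n. h n / real n) \<longlonglongrightarrow> L"
  shows "AE \<omega> in coin_space. (\<lambda>n. f n \<omega> / real n) \<longlonglongrightarrow> L"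
proof -
  \<comment> \<open>Block lengths and margins range over countable sets, so one null set serves for
    all of them before the limit is examined pointwise.\<close>
  have "AE \<omega> in coin_space. \<forall>m. m \<ge> 1 \<longrightarrow>
      (\<forall>\<^sub>F n in sequentially. f n \<omega> \<le> (h m + 1) / real m * real n + C * real m)"
    unfolding AE_all_countable using AE_eventually_upper by (auto simp: AE_all_countable)
  moreover have "AE \<omega> in coin_space. \<forall>j k. \<forall>\<^sub>F n in sequentially.
      (L - 1 / Suc j - 1 / Suc k) * real n \<le> f n \<omega>"
    unfolding AE_all_countable[where P = "\<lambda>\<omega> j. \<forall>k. _ j k \<omega>"]
    by (intro allI AE_eventually_lower[OF L]) simp
  ultimately show ?thesis
  proof eventually_elim
    case (elim \<omega>)
    show ?case
    proof (rule order_tendstoI)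
      fix d assume "d < L"
      then have "0 < (L - d) / 2" by simp
      then obtain j where "1 / real (Suc j) < (L - d) / 2" by (rule nat_approx_posE)
      then have j: "1 / real (Suc j) + 1 / real (Suc j) < L - d"
        by (metis add_strict_mono field_sum_of_halves)
      from elim(2) have "\<forall>\<^sub>F n in sequentially. (L - 1 / Suc j - 1 / Suc j) * real n \<le> f n \<omega>"
        by blast
      then show "\<forall>\<^sub>F n in sequentially. d < f n \<omega> / real n"
        using eventually_gt_at_top[of 0]
      proof eventually_elim
        case (elim n)
        have "L - 1 / Suc j - 1 / Suc j \<le> f n \<omega> / real n"
          using elim by (simp add: field_simps)
        with j show ?case by linarith
      qed
    next
      fix d assume d: "L < d"
      have "(\<lambda>m. h m / real m + 1 / real m) \<longlonglongrightarrow> L + 0"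
        by (intro tendsto_add L lim_const_over_n)
      then have "\<forall>\<^sub>F m in sequentially. h m / real m + 1 / real m < d"
        using d by (intro order_tendstoD) auto
      then have "\<forall>\<^sub>F m in sequentially. h m / real m + 1 / real m < d \<and> m \<ge> 1"
        using eventually_ge_at_top[of 1] by eventually_elim simp
      then obtain m where m: "(h m + 1) / real m < d" "m \<ge> 1"
        by (auto simp: eventually_sequentially add_divide_distrib)
      have "(\<lambda>n. (h m + 1) / real m + C * real m / real n) \<longlonglongrightarrow> (h m + 1) / real m + 0"
        by (intro tendsto_intros lim_const_over_n)
      then have "\<forall>\<^sub>F n in sequentially. (h m + 1) / real m + C * real m / real n < d"
        using m by (intro order_tendstoD) auto
      moreover have "\<forall>\<^sub>F n in sequentially. f n \<omega> \<le> (h m + 1) / real m * real n + C * real m"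
        using elim(1) m(2) by blast
      ultimately show "\<forall>\<^sub>F n in sequentially. f n \<omega> / real n < d"
        using eventually_gt_at_top[of 0]
      proof eventually_elim
        case (elim n)
        have "f n \<omega> / real n \<le> ((h m + 1) / real m * real n + C * real m) / real n"
          using elim(2) by (rule divide_right_mono) simp
        also have "\<dots> = (h m + 1) / real m + C * real m / real n"
          using elim(3) by (simp add: add_divide_distrib)
        finally show ?case using elim(1) by linarith
      qed
    qed
  qed
qed

end

subsection \<open>Garsia separation\<close>

text \<open>Infinite descent: modulo 2 the equation forces \<open>a\<close> and \<open>b\<close> to
  be even, and halving both gives a smaller solution. The form \<open>a * a + a * b - b * b\<close>
  is the norm of \<open>a + b * golden\<close>.\<close>

lemma norm_form_eq_0:
  fixes a b :: int
  assumes "a * a + a * b = b * b"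
  shows "a = 0 \<and> b = 0"
  using assms
proof (induction "nat \<bar>a\<bar>" arbitrary: a b rule: less_induct)
  case less
  have "even (a * a + a * b) = even (b * b)" using less.prems by simp
  then have "even a" "even b" by auto
  then obtain x y where xy: "a = 2 * x" "b = 2 * y" by (auto elim!: evenE)
  show ?case
  proof (cases "a = 0")
    case True
    then show ?thesis using less.prems by simp
  next
    case False
    then have "nat \<bar>x\<bar> < nat \<bar>a\<bar>" using xy by auto
    moreover have "x * x + x * y = y * y" using less.prems xy by (simp add: algebra_simps)
    ultimately have "x = 0 \<and> y = 0" by (rule less.hyps)
    then show ?thesis using xy by simp
  qed
qed

lemma golden_mult_golden: "golden * golden = golden + 1"
  using golden_squared by (simp add: power2_eq_square)

lemma golden_mult_golden_left: "golden * (golden * x) = x + golden * x"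
  using golden_mult_golden by (simp add: distrib_right flip: mult.assoc)

text \<open>\<open>1 - golden = - 1 / golden\<close> is the algebraic conjugate of \<open>golden\<close>.\<close>

lemma one_le_norm:
  fixes a b :: int
  assumes "of_int a + of_int b * golden \<noteq> 0"
  shows "1 \<le> \<bar>of_int a + of_int b * golden\<bar> * \<bar>of_int a + of_int b * (1 - golden)\<bar>"
proof -
  have "a * a + a * b - b * b \<noteq> 0"
    using norm_form_eq_0[of a b] assms by auto
  then have "1 \<le> \<bar>a * a + a * b - b * b\<bar>" by linarith
  then have "1 \<le> \<bar>real_of_int (a * a + a * b - b * b)\<bar>"
    by (simp only: of_int_1_le_iff flip: of_int_abs)
  also have "real_of_int (a * a + a * b - b * b) =
      (of_int a + of_int b * golden) * (of_int a + of_int b * (1 - golden))"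
    by (simp add: algebra_simps golden_mult_golden golden_mult_golden_left)
  finally show ?thesis by (simp add: abs_mult)
qed

text \<open>Horner's scheme: a new digit multiplies the numerator by \<open>golden\<close> and adds
  0 or 1. On the conjugate the multiplier has modulus \<open>golden - 1 < 1\<close>, and
  \<open>golden ^ 2\<close> is the fixed point of \<open>t \<mapsto> t * (golden - 1) + 1\<close>,
  so the bound reproduces itself.\<close>

lemma partial_sum_as_quadratic_integer:
  "\<exists>a b :: int. partial_sum n \<omega> = (of_int a + of_int b * golden) / golden ^ (n + 1) \<and>
     \<bar>of_int a + of_int b * (1 - golden)\<bar> \<le> golden ^ 2"
proof (induction n)
  case 0
  then show ?case
    by (intro exI[of _ 0]) (simp add: partial_sum_def)
next
  case (Suc n)
  then obtain a b :: int where ab: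
    "partial_sum n \<omega> = (of_int a + of_int b * golden) / golden ^ (n + 1)"
    "\<bar>of_int a + of_int b * (1 - golden)\<bar> \<le> golden ^ 2" by blast
  define e :: int where "e = of_bool (\<omega> n)"
  have g: "golden > 0" using golden_gt_1 by simp
  have "partial_sum (Suc n) \<omega> = partial_sum n \<omega> + of_int e / golden ^ (n + 2)"
    by (simp add: partial_sum_def digit_term_def e_def)
  also have "\<dots> = ((of_int a + of_int b * golden) * golden + of_int e) / golden ^ (n + 2)"
    unfolding ab(1) using g by (simp add: field_simps)
  also have "(of_int a + of_int b * golden) * golden + of_int e =
      of_int (b + e) + of_int (a + b) * golden"
    by (simp add: algebra_simps golden_mult_golden golden_mult_golden_left)
  finally have 1: "partial_sum (Suc n) \<omega> = (of_int (b + e) + of_int (a + b) * golden) / golden ^ (Suc n + 1)"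
    by simp
  have "of_int (b + e) + of_int (a + b) * (1 - golden) =
      (of_int a + of_int b * (1 - golden)) * (1 - golden) + of_int e"
    by (simp add: algebra_simps golden_mult_golden golden_mult_golden_left)
  also have "\<bar>\<dots>\<bar> \<le> \<bar>of_int a + of_int b * (1 - golden)\<bar> * (golden - 1) + 1"
  proof -
    have "\<bar>real_of_int e\<bar> \<le> 1" by (simp add: e_def)
    moreover have "\<bar>(of_int a + of_int b * (1 - golden)) * (1 - golden)\<bar> =
        \<bar>of_int a + of_int b * (1 - golden)\<bar> * (golden - 1)"
      using golden_gt_1 by (simp add: abs_mult)
    ultimately show ?thesis by linarith
  qed
  also have "\<dots> \<le> golden ^ 2 * (golden - 1) + 1"
    using ab(2) golden_gt_1 by (intro add_mono mult_right_mono) auto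
  also have "\<dots> = golden ^ 2"
    using golden_mult_golden by (simp add: power2_eq_square algebra_simps)
  finally show ?case using 1 by blast
qed

text \<open>The norm of a nonzero element of \<open>\<int>[golden]\<close> is a nonzero integer, so an element with bounded
  conjugate stays away from 0.\<close>

lemma partial_sum_separation:
  assumes "partial_sum n \<omega> \<noteq> partial_sum n \<omega>'"
  shows "1 / (2 * golden ^ (n + 3)) \<le> \<bar>partial_sum n \<omega> - partial_sum n \<omega>'\<bar>"
proof -
  have g: "golden > 0" using golden_gt_1 by simp
  obtain a b :: int where ab:
    "partial_sum n \<omega> = (of_int a + of_int b * golden) / golden ^ (n + 1)"
    "\<bar>of_int a + of_int b * (1 - golden)\<bar> \<le> golden ^ 2"
    using partial_sum_as_quadratic_integer by blast
  obtain a' b' :: int where ab':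
    "partial_sum n \<omega>' = (of_int a' + of_int b' * golden) / golden ^ (n + 1)"
    "\<bar>of_int a' + of_int b' * (1 - golden)\<bar> \<le> golden ^ 2"
    using partial_sum_as_quadratic_integer by blast
  define D where "D = of_int (a - a') + of_int (b - b') * golden"
  define D' where "D' = of_int (a - a') + of_int (b - b') * (1 - golden)"
  have D: "partial_sum n \<omega> - partial_sum n \<omega>' = D / golden ^ (n + 1)"
    unfolding ab ab' D_def by (simp add: diff_divide_distrib algebra_simps add_divide_distrib)
  with assms have "D \<noteq> 0" by auto
  have D': "D' = (of_int a + of_int b * (1 - golden)) - (of_int a' + of_int b' * (1 - golden))"
    by (simp add: D'_def algebra_simps)
  have "1 \<le> \<bar>D\<bar> * \<bar>D'\<bar>"
    using one_le_norm[of "a - a'" "b - b'"] \<open>D \<noteq> 0\<close> by (simp add: D_def D'_def)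
  also have "\<bar>D'\<bar> \<le> 2 * golden ^ 2"
    using ab(2) ab'(2) unfolding D' by linarith
  finally have "1 \<le> \<bar>D\<bar> * (2 * golden ^ 2)"
    by (simp add: mult_left_mono)
  then have "1 / (2 * golden ^ 2) / golden ^ (n + 1) \<le> \<bar>D\<bar> / golden ^ (n + 1)"
    using g by (intro divide_right_mono) (auto simp: divide_le_eq)
  also have "\<dots> = \<bar>partial_sum n \<omega> - partial_sum n \<omega>'\<bar>"
    using g by (simp add: D abs_divide)
  also have "1 / (2 * golden ^ 2) / golden ^ (n + 1) = 1 / (2 * golden ^ (n + 3))"
    by (simp add: power_add power2_eq_square power3_eq_cube)
  finally show ?thesis .
qed

text \<open>Points at mutual distance at least \<open>\<delta>\<close> have different values of
  \<open>\<lfloor>u / \<delta>\<rfloor>\<close>, which reduces the claim to counting integers in an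
  interval.\<close>

lemma card_separated_le:
  fixes A :: "real set"
  assumes \<delta>: "\<delta> > 0" and sep: "\<And>u v. u \<in> A \<Longrightarrow> v \<in> A \<Longrightarrow> u \<noteq> v \<Longrightarrow> \<delta> \<le> \<bar>u - v\<bar>"
    and A: "A \<subseteq> {x - r..x + r}" and r: "r \<ge> 0"
  shows "real (card A) \<le> 2 * r / \<delta> + 2"
proof -
  define F where "F = (\<lambda>u :: real. \<lfloor>u / \<delta>\<rfloor>)"
  have "inj_on F A"
  proof (rule inj_onI, rule ccontr)
    fix u v assume uv: "u \<in> A" "v \<in> A" "F u = F v" "u \<noteq> v"
    then have "\<delta> \<le> \<bar>u - v\<bar>" by (intro sep)
    then have "1 \<le> \<bar>u / \<delta> - v / \<delta>\<bar>"
      using \<delta> by (simp add: field_simps flip: diff_divide_distrib)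
    with uv(3) show False unfolding F_def by linarith
  qed
  moreover have "F ` A \<subseteq> {\<lfloor>(x - r) / \<delta>\<rfloor>..\<lfloor>(x + r) / \<delta>\<rfloor>}"
    unfolding F_def using A \<delta> by (force intro!: floor_mono divide_right_mono)
  ultimately have "card A \<le> card {\<lfloor>(x - r) / \<delta>\<rfloor>..\<lfloor>(x + r) / \<delta>\<rfloor>}"
    by (metis card_image card_mono finite_atLeastAtMost_int)
  also have "real \<dots> \<le> (x + r) / \<delta> - (x - r) / \<delta> + 2"
  proof -
    have "(x - r) / \<delta> \<le> (x + r) / \<delta>" using r \<delta> by (intro divide_right_mono) auto
    then show ?thesis by (simp add: of_nat_nat) linarith
  qed
  also have "\<dots> = 2 * r / \<delta> + 2"
    by (simp flip: diff_divide_distrib)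
  finally show ?thesis by simp
qed

text \<open>An expansion exceeds its \<open>n\<close>-th partial sum by at most
  \<open>1 / golden ^ n\<close>. Two expansions closer than \<open>1 / golden ^ n\<close> thus have
  partial sums at distance at most twice that, whence the radius.\<close>

definition neighbours :: "nat \<Rightarrow> real \<Rightarrow> real set" where
  "neighbours n w = {u \<in> range (partial_sum n). \<bar>u - w\<bar> \<le> 2 / golden ^ n}"

text \<open>The count from \<open>card_separated_le\<close> for radius \<open>2 / golden ^ n\<close>
  and separation \<open>1 / (2 * golden ^ (n + 3))\<close>; the powers of \<open>golden\<close>
  depending on \<open>n\<close> cancel.\<close>

definition neighbour_bound :: real where
  "neighbour_bound = 8 * golden ^ 3 + 2"

lemma finite_neighbours [simp]: "finite (neighbours n w)"
  unfolding neighbours_def using finite_range_partial_sum by simp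

lemma card_neighbours: "real (card (neighbours n w)) \<le> neighbour_bound"
proof -
  have g: "golden > 0" using golden_gt_1 by simp
  have "real (card (neighbours n w)) \<le> 2 * (2 / golden ^ n) / (1 / (2 * golden ^ (n + 3))) + 2"
  proof (rule card_separated_le[where x = w])
    fix u v assume "u \<in> neighbours n w" "v \<in> neighbours n w" "u \<noteq> v"
    then show "1 / (2 * golden ^ (n + 3)) \<le> \<bar>u - v\<bar>"
      using partial_sum_separation by (auto simp: neighbours_def)
  qed (use g in \<open>auto simp: neighbours_def abs_le_iff\<close>)
  also have "\<dots> = neighbour_bound"
    using g by (simp add: neighbour_bound_def power_add)
  finally show ?thesis .
qed

subsection \<open>Information of the partial sums\<close>

definition pmass :: "nat \<Rightarrow> real \<Rightarrow> real" where
  "pmass n w = coin.prob {\<omega>. partial_sum n \<omega> = w}"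

lemma sets_partial_sum_eq [measurable]: "{\<omega>. partial_sum n \<omega> = w} \<in> sets coin_space"
proof -
  have "{\<omega> \<in> space coin_space. partial_sum n \<omega> = w} \<in> sets coin_space" by measurable
  then show ?thesis by simp
qed

lemma sets_partial_sum_in [measurable]: "{\<omega>. partial_sum n \<omega> \<in> A} \<in> sets coin_space"
proof -
  have "{\<omega>. partial_sum n \<omega> \<in> A} = (\<Union>w\<in>A \<inter> range (partial_sum n). {\<omega>. partial_sum n \<omega> = w})"
    by auto
  also have "\<dots> \<in> sets coin_space"
    using finite_range_partial_sum by (intro sets.finite_UN) auto
  finally show ?thesis .
qed

lemma prob_partial_sum_in:
  assumes "finite A"
  shows "coin.prob {\<omega>. partial_sum n \<omega> \<in> A} = (\<Sum>w\<in>A. pmass n w)"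
proof -
  have "{\<omega>. partial_sum n \<omega> \<in> A} = (\<Union>w\<in>A. {\<omega>. partial_sum n \<omega> = w})" by auto
  then show ?thesis
    unfolding pmass_def
    by (simp only:) (rule coin.finite_measure_finite_Union, use assms in \<open>auto simp: disjoint_family_on_def\<close>)
qed

lemma partial_sum_prefix:
  "(\<And>k. k < n \<Longrightarrow> \<omega> k = \<omega>' k) \<Longrightarrow> partial_sum n \<omega> = partial_sum n \<omega>'"
  unfolding partial_sum_def digit_term_def by (intro sum.cong) auto

text \<open>A digit string for \<open>u\<close> followed by one for \<open>v\<close> represents the
  combined value, and the two parts are independent. Equality can fail because other strings may
  represent the same value.\<close>

lemma pmass_mult_le: "pmass n u * pmass m v \<le> pmass (n + m) (u + v / golden ^ n)"
proof -
  have "pmass n u * pmass m v =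
      coin.prob ({\<omega>. partial_sum n \<omega> = u} \<inter> lshift n -` {\<omega>. partial_sum m \<omega> = v})"
    unfolding pmass_def
    by (rule prob_prefix_Int_lshift[symmetric]) (auto dest: partial_sum_prefix)
  also have "\<dots> \<le> pmass (n + m) (u + v / golden ^ n)"
    unfolding pmass_def
    by (rule coin.finite_measure_mono[OF _ sets_partial_sum_eq]) (auto simp: partial_sum_add lshift_def)
  finally show ?thesis .
qed

lemma pmass_1_ge: "1 / 2 \<le> pmass 1 (partial_sum 1 \<omega>)"
proof -
  have "1 / 2 = measure (measure_pmf (bernoulli_pmf (1/2))) {\<omega> 0}"
    by (cases "\<omega> 0") (simp_all add: measure_pmf_single)
  also have "measure_pmf (bernoulli_pmf (1/2)) =
      distr coin_space (measure_pmf (bernoulli_pmf (1/2))) (\<lambda>\<omega>. \<omega> 0)"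
  proof -
    interpret product_prob_space "\<lambda>_. measure_pmf (bernoulli_pmf (1/2))" "UNIV :: nat set" ..
    show ?thesis unfolding coin_space_def by (rule PiM_component[symmetric]) auto
  qed
  also have "measure \<dots> {\<omega> 0} = coin.prob ((\<lambda>\<omega>'. \<omega>' 0) -` {\<omega> 0} \<inter> space coin_space)"
    by (rule measure_distr[OF measurable_coordinate]) simp
  also have "\<dots> \<le> pmass 1 (partial_sum 1 \<omega>)"
    unfolding pmass_def
    by (rule coin.finite_measure_mono[OF _ sets_partial_sum_eq]) (auto simp: partial_sum_def digit_term_def)
  finally show ?thesis .
qed

lemma pmass_0: "pmass 0 (partial_sum 0 \<omega>) = 1"
  using coin.prob_space by (simp add: pmass_def partial_sum_def)

text \<open>Already the single string of the first \<open>n\<close> digits has probability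
  \<open>1 / 2 ^ n\<close>. This provides the linear bound on \<open>info\<close> with constant
  \<open>ln 2\<close>.\<close>

lemma pmass_ge: "1 / 2 ^ n \<le> pmass n (partial_sum n \<omega>)"
proof (induction n arbitrary: \<omega>)
  case (Suc n)
  have "1 / 2 ^ Suc n = 1 / 2 * (1 / 2 ^ n :: real)" by simp
  also have "\<dots> \<le> pmass 1 (partial_sum 1 \<omega>) * pmass n (partial_sum n (lshift 1 \<omega>))"
    by (intro mult_mono pmass_1_ge Suc.IH) (auto simp: pmass_def)
  also have "\<dots> \<le> pmass (Suc n) (partial_sum (Suc n) \<omega>)"
    using pmass_mult_le[of 1 "partial_sum 1 \<omega>" n "partial_sum n (lshift 1 \<omega>)"] partial_sum_add[of 1 n \<omega>]
    by (simp add: lshift_def)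
  finally show ?case .
qed (simp add: pmass_0)

lemma pmass_pos: "0 < pmass n (partial_sum n \<omega>)"
  by (rule less_le_trans[OF _ pmass_ge]) simp

lemma pmass_le_1: "pmass n w \<le> 1"
  by (simp add: pmass_def)

definition info :: "nat \<Rightarrow> (nat \<Rightarrow> bool) \<Rightarrow> real" where
  "info n \<omega> = - ln (pmass n (partial_sum n \<omega>))"

lemma exp_minus_info: "exp (- info n \<omega>) = pmass n (partial_sum n \<omega>)"
  by (simp add: info_def pmass_pos)

interpretation info: coin_subadditive info "ln 2"
proof
  fix n
  have "simple_function coin_space (\<lambda>\<omega>. - ln (pmass n (partial_sum n \<omega>)))"
    by (rule simple_function_compose1[OF simple_function_partial_sum])
  then show "info n \<in> borel_measurable coin_space"
    by (intro borel_measurable_simple_function) (simp add: info_def[abs_def])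
  fix \<omega>
  show "0 \<le> info n \<omega>"
    using pmass_pos[of n \<omega>] pmass_le_1 by (simp add: info_def)
  have "ln (1 / 2 ^ n) \<le> ln (pmass n (partial_sum n \<omega>))"
    using pmass_ge[of n \<omega>] pmass_pos by (subst ln_le_cancel_iff) auto
  then show "info n \<omega> \<le> ln 2 * real n"
    by (simp add: info_def ln_div ln_realpow[of 2] mult.commute[of "ln 2"])
  fix m
  have "ln (pmass n (partial_sum n \<omega>) * pmass m (partial_sum m (lshift n \<omega>)))
      \<le> ln (pmass (n + m) (partial_sum (n + m) \<omega>))"
    using pmass_mult_le[of n "partial_sum n \<omega>" m "partial_sum m (lshift n \<omega>)"]
    by (subst ln_le_cancel_iff) (simp_all add: pmass_pos, simp add: partial_sum_add lshift_def)
  then show "info (n + m) \<omega> \<le> info n \<omega> + info m (lshift n \<omega>)"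
    using pmass_pos[of n \<omega>] pmass_pos[of m "lshift n \<omega>"] by (simp add: info_def ln_mult)
next
  fix n and \<omega> \<omega>' :: "nat \<Rightarrow> bool" assume "\<And>k. k < n \<Longrightarrow> \<omega> k = \<omega>' k"
  then have "partial_sum n \<omega> = partial_sum n \<omega>'" by (rule partial_sum_prefix)
  then show "info n \<omega> = info n \<omega>'" by (simp add: info_def)
qed

lemma expectation_info: "coin.expectation (info n) = shannon_entropy coin_space (partial_sum n)"
proof -
  have "info n \<omega> = (\<Sum>w\<in>range (partial_sum n). - ln (pmass n w) * indicator {\<omega>. partial_sum n \<omega> = w} \<omega>)" for \<omega>
  proof -
    have "info n \<omega> = (\<Sum>w\<in>range (partial_sum n). if partial_sum n \<omega> = w then - ln (pmass n w) else 0)"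
      by (simp add: info_def sum.delta' finite_range_partial_sum)
    also have "\<dots> = (\<Sum>w\<in>range (partial_sum n). - ln (pmass n w) * indicator {\<omega>. partial_sum n \<omega> = w} \<omega>)"
      by (intro sum.cong) auto
    finally show ?thesis .
  qed
  then have "info n = (\<lambda>\<omega>. \<Sum>w\<in>range (partial_sum n). - ln (pmass n w) * indicator {\<omega>. partial_sum n \<omega> = w} \<omega>)"
    by (rule ext)
  then have "coin.expectation (info n) =
      (\<Sum>w\<in>range (partial_sum n). - ln (pmass n w) * pmass n w)"
  proof (simp only:, subst Bochner_Integration.integral_sum)
    show "integrable coin_space (\<lambda>\<omega>. - ln (pmass n w) * indicator {\<omega>. partial_sum n \<omega> = w} \<omega>)" for w
      by (intro integrable_mult_right integrable_real_indicator) (simp_all add: coin.emeasure_eq_measure)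
  qed (simp add: pmass_def)
  then show ?thesis
    by (simp add: shannon_entropy_def Let_def pmass_def sum_negf mult.commute)
qed

text \<open>The mean of \<open>info n\<close> is the Shannon entropy, so the growth rate is the
  entropy per digit; the factor \<open>ln golden\<close> undoes the normalisation in
  \<open>garsia_entropy\<close>.\<close>

lemma AE_info:
  "AE \<omega> in coin_space. (\<lambda>n. info n \<omega> / real n) \<longlonglongrightarrow> garsia_entropy * ln golden"
proof (rule info.AE_tendsto)
  have "(\<lambda>n. shannon_entropy coin_space (partial_sum n) / (real n * ln golden) * ln golden)
      \<longlonglongrightarrow> garsia_entropy * ln golden"
    by (intro tendsto_intros garsia_entropy_limit)
  moreover have "ln golden \<noteq> 0" using golden_gt_1 by simp
  ultimately show "(\<lambda>n. coin.expectation (info n) / real n) \<longlonglongrightarrow> garsia_entropy * ln golden"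
    by (simp add: expectation_info)
qed

subsection \<open>Small balls\<close>

definition expansion :: "(nat \<Rightarrow> bool) \<Rightarrow> real" where
  "expansion \<omega> = (\<Sum>k. digit_term k \<omega>)"

lemma measurable_expansion [measurable]: "expansion \<in> borel_measurable coin_space"
  unfolding expansion_def[abs_def] by measurable

lemma erdos_measure_eq_distr: "erdos_measure = distr coin_space borel expansion"
  by (simp add: erdos_measure_def expansion_def[abs_def])

lemma expansion_split: "expansion \<omega> = partial_sum n \<omega> + expansion (lshift n \<omega>) / golden ^ n"
proof -
  have "digit_term (k + n) \<omega> = digit_term k (lshift n \<omega>) / golden ^ n" for k
    by (simp add: digit_term_def lshift_def power_add add.commute)
  then have "(\<Sum>k. digit_term (k + n) \<omega>) = expansion (lshift n \<omega>) / golden ^ n"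
    by (simp add: expansion_def suminf_divide[OF summable_digit_term])
  then show ?thesis
    using suminf_split_initial_segment[OF summable_digit_term, of \<omega> n]
    by (simp add: expansion_def partial_sum_def)
qed

lemma expansion_bounds:
  "partial_sum n \<omega> \<le> expansion \<omega>" "expansion \<omega> \<le> partial_sum n \<omega> + 1 / golden ^ n"
proof -
  have "expansion (lshift n \<omega>) \<in> {0..1}"
    unfolding expansion_def by (rule suminf_digit_term_bounds)
  then show "partial_sum n \<omega> \<le> expansion \<omega>" "expansion \<omega> \<le> partial_sum n \<omega> + 1 / golden ^ n"
    using golden_gt_1 unfolding expansion_split[of \<omega> n] by (auto intro: divide_right_mono)
qed

lemma sets_dist_expansion [measurable]: "{\<omega>. dist x (expansion \<omega>) < r} \<in> sets coin_space"
proof -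
  have "{\<omega> \<in> space coin_space. dist x (expansion \<omega>) < r} \<in> sets coin_space" by measurable
  then show ?thesis by simp
qed

lemma erdos_measure_ball:
  "measure erdos_measure (ball x r) = coin.prob {\<omega>. dist x (expansion \<omega>) < r}"
  unfolding erdos_measure_eq_distr by (subst measure_distr) (auto simp: vimage_def)

text \<open>Expansions sharing their \<open>n\<close>-th partial sum lie in a closed interval of
  length \<open>1 / golden ^ n\<close>; the radius must be strictly larger because the ball is
  open.\<close>

lemma pmass_le_erdos_measure_ball:
  assumes "1 / golden ^ n < r"
  shows "pmass n (partial_sum n \<omega>) \<le> measure erdos_measure (ball (expansion \<omega>) r)"
  unfolding pmass_def erdos_measure_ball
proof (rule coin.finite_measure_mono)
  show "{\<omega>'. partial_sum n \<omega>' = partial_sum n \<omega>} \<subseteq> {\<omega>'. dist (expansion \<omega>) (expansion \<omega>') < r}"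
  proof safe
    fix \<omega>' assume "partial_sum n \<omega>' = partial_sum n \<omega>"
    then show "dist (expansion \<omega>) (expansion \<omega>') < r"
      using expansion_bounds[where n = n and \<omega> = \<omega>] expansion_bounds[where n = n and \<omega> = \<omega>'] assms
      unfolding dist_real_def by linarith
  qed
qed measurable

lemma erdos_measure_ball_le:
  "measure erdos_measure (ball (expansion \<omega>) (1 / golden ^ n)) \<le>
     (\<Sum>u\<in>neighbours n (partial_sum n \<omega>). pmass n u)"
  unfolding erdos_measure_ball prob_partial_sum_in[OF finite_neighbours, symmetric]
proof (rule coin.finite_measure_mono)
  show "{\<omega>'. dist (expansion \<omega>) (expansion \<omega>') < 1 / golden ^ n} \<subseteq>
      {\<omega>'. partial_sum n \<omega>' \<in> neighbours n (partial_sum n \<omega>)}"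
  proof safe
    fix \<omega>' assume *: "dist (expansion \<omega>) (expansion \<omega>') < 1 / golden ^ n"
    have "\<bar>partial_sum n \<omega>' - partial_sum n \<omega>\<bar> \<le> 1 / golden ^ n + 1 / golden ^ n"
      using expansion_bounds[where n = n and \<omega> = \<omega>] expansion_bounds[where n = n and \<omega> = \<omega>'] *
      unfolding dist_real_def by linarith
    then show "partial_sum n \<omega>' \<in> neighbours n (partial_sum n \<omega>)"
      by (simp add: neighbours_def flip: add_divide_distrib)
  qed
qed measurable

abbreviation info_rate :: real where
  "info_rate \<equiv> garsia_entropy * ln golden"

text \<open>With \<open>h = info_rate\<close>, at most \<open>exp (n (h - \<epsilon>))\<close> points have mass above \<open>exp (- n (h - \<epsilon>))\<close>, so few points have
  such a neighbour, and a typical point, of mass below \<open>exp (- n (h - \<epsilon> / 2))\<close>, is not one of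
  them.\<close>

lemma AE_neighbours_small:
  fixes \<epsilon> :: real
  assumes \<epsilon>: "\<epsilon> > 0"
  shows "AE \<omega> in coin_space. \<forall>\<^sub>F n in sequentially.
    \<forall>u\<in>neighbours n (partial_sum n \<omega>). pmass n u \<le> exp (- (real n * (info_rate - \<epsilon>)))"
proof -
  define T where "T = (\<lambda>n. {u \<in> range (partial_sum n). exp (- (real n * (info_rate - \<epsilon>))) < pmass n u})"
  \<comment> \<open>The allowance is \<open>\<epsilon>\<close> for the heavy points in
    \<open>T n\<close> but only \<open>\<epsilon> / 2\<close> for their light neighbours. The
    product of cardinality and mass then decays like \<open>exp (- n \<epsilon> / 2)\<close>, which
    is summable.\<close>
  define W where "W = (\<lambda>n. {w \<in> \<Union>u\<in>T n. neighbours n u. pmass n w \<le> exp (- (real n * (info_rate - \<epsilon> / 2)))})"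
  define E where "E = (\<lambda>n. {\<omega>. partial_sum n \<omega> \<in> W n})"
  have finT: "finite (T n)" for n
    unfolding T_def using finite_range_partial_sum by simp
  have finW: "finite (W n)" for n
    unfolding W_def using finT by auto
  have K: "neighbour_bound \<ge> 0"
    using golden_gt_1 by (simp add: neighbour_bound_def)
  have cardT: "real (card (T n)) \<le> exp (real n * (info_rate - \<epsilon>))" for n
  proof -
    have "real (card (T n)) * exp (- (real n * (info_rate - \<epsilon>))) =
        (\<Sum>u\<in>T n. exp (- (real n * (info_rate - \<epsilon>))))" by simp
    also have "\<dots> \<le> (\<Sum>u\<in>T n. pmass n u)"
      by (rule sum_mono) (auto simp: T_def)
    also have "\<dots> \<le> 1"
      unfolding prob_partial_sum_in[OF finT, symmetric] by simp
    finally show ?thesis by (simp only: exp_minus flip: divide_inverse) simp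
  qed
  have le: "coin.prob (E n) \<le> neighbour_bound * exp (- \<epsilon> / 2) ^ n" for n
  proof -
    have "card (W n) \<le> card (\<Union>u\<in>T n. neighbours n u)"
      by (rule card_mono) (use finT in \<open>auto simp: W_def\<close>)
    also have "\<dots> \<le> (\<Sum>u\<in>T n. card (neighbours n u))"
      by (rule card_UN_le[OF finT])
    finally have "real (card (W n)) \<le> (\<Sum>u\<in>T n. real (card (neighbours n u)))"
      by (metis of_nat_le_iff of_nat_sum)
    also have "\<dots> \<le> (\<Sum>u\<in>T n. neighbour_bound)"
      by (intro sum_mono card_neighbours)
    also have "\<dots> \<le> exp (real n * (info_rate - \<epsilon>)) * neighbour_bound"
      using cardT[of n] K by (simp add: mult_right_mono)
    finally have W: "real (card (W n)) \<le> exp (real n * (info_rate - \<epsilon>)) * neighbour_bound" .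
    have "coin.prob (E n) = (\<Sum>w\<in>W n. pmass n w)"
      unfolding E_def by (rule prob_partial_sum_in[OF finW])
    also have "\<dots> \<le> (\<Sum>w\<in>W n. exp (- (real n * (info_rate - \<epsilon> / 2))))"
      by (rule sum_mono) (auto simp: W_def)
    also have "\<dots> \<le> exp (real n * (info_rate - \<epsilon>)) * neighbour_bound * exp (- (real n * (info_rate - \<epsilon> / 2)))"
      using W by (simp add: mult_right_mono)
    also have "\<dots> = neighbour_bound * exp (real n * (info_rate - \<epsilon>) + - (real n * (info_rate - \<epsilon> / 2)))"
      unfolding exp_add by simp
    also have "real n * (info_rate - \<epsilon>) + - (real n * (info_rate - \<epsilon> / 2)) = real n * (- \<epsilon> / 2)"
      by (simp add: field_simps)
    finally show ?thesis by (simp only: exp_of_nat_mult)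
  qed
  have "summable (\<lambda>n. neighbour_bound * exp (- \<epsilon> / 2) ^ n)"
    using \<epsilon> by (intro summable_mult summable_geometric) auto
  then have "summable (\<lambda>n. coin.prob (E n))"
    by (rule summable_comparison_test'[of _ 0]) (use le in auto)
  then have "AE \<omega> in coin_space. \<forall>\<^sub>F n in sequentially. \<omega> \<in> space coin_space - E n"
    by (intro borel_cantelli_AE1) (auto simp: coin.emeasure_eq_measure E_def)
  with AE_info show ?thesis
  proof eventually_elim
    case (elim \<omega>)
    have "\<forall>\<^sub>F n in sequentially. info_rate - \<epsilon> / 2 < info n \<omega> / real n"
      using elim(1) \<epsilon> by (intro order_tendstoD) auto
    with elim(2) eventually_gt_at_top[of 0] show ?case
    proof eventually_elim
      case (elim n)
      have "real n * (info_rate - \<epsilon> / 2) \<le> info n \<omega>"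
        using elim(2,3) by (simp add: field_simps)
      then have small: "pmass n (partial_sum n \<omega>) \<le> exp (- (real n * (info_rate - \<epsilon> / 2)))"
        unfolding exp_minus_info[symmetric] by simp
      show ?case
      proof (rule ballI, rule ccontr)
        fix u assume u: "u \<in> neighbours n (partial_sum n \<omega>)"
          "\<not> pmass n u \<le> exp (- (real n * (info_rate - \<epsilon>)))"
        \<comment> \<open>Being a neighbour is symmetric, so a heavy neighbour of the current point
          has that point among its own neighbours.\<close>
        then have "u \<in> T n" "partial_sum n \<omega> \<in> neighbours n u"
          by (auto simp: T_def neighbours_def abs_minus_commute)
        with small have "\<omega> \<in> E n" by (auto simp: E_def W_def)
        with elim(1) show False by simp
      qed
    qed
  qed
qed

section \<open>Convergence along the radii \<open>1 / golden ^ n\<close>\<close>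

definition ball_info :: "nat \<Rightarrow> real \<Rightarrow> real" where
  "ball_info n x = - ln (measure erdos_measure (ball x (1 / golden ^ n)))"

lemma ex_inverse_golden_power_less:
  assumes "r > 0" shows "\<exists>n. 1 / golden ^ n < r"
  using real_arch_pow_inv[OF assms, of "1 / golden"] golden_gt_1 by (simp add: power_divide)

lemma erdos_measure_ball_pos: "r > 0 \<Longrightarrow> 0 < measure erdos_measure (ball (expansion \<omega>) r)"
  using ex_inverse_golden_power_less pmass_le_erdos_measure_ball pmass_pos less_le_trans by blast

lemma tendsto_shifted_rate:
  fixes a :: "nat \<Rightarrow> real"
  assumes "(\<lambda>n. a n / real n) \<longlonglongrightarrow> L"
  shows "(\<lambda>n. a (Suc n) / real n) \<longlonglongrightarrow> L"
proof -
  have "(\<lambda>n. a (Suc n) / real (Suc n) * (real (Suc n) / real n)) \<longlonglongrightarrow> L * 1"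
    by (intro tendsto_mult LIMSEQ_Suc[OF assms] LIMSEQ_Suc_n_over_n)
  then show ?thesis by (simp del: of_nat_Suc)
qed

lemma AE_ball_info:
  "AE \<omega> in coin_space. (\<lambda>n. ball_info n (expansion \<omega>) / real n) \<longlonglongrightarrow> info_rate"
proof -
  have "AE \<omega> in coin_space. \<forall>j. \<forall>\<^sub>F n in sequentially.
      \<forall>u\<in>neighbours n (partial_sum n \<omega>). pmass n u \<le> exp (- (real n * (info_rate - 1 / Suc j)))"
    unfolding AE_all_countable by (intro allI AE_neighbours_small) simp
  with AE_info show ?thesis
  proof eventually_elim
    case (elim \<omega>)
    have K: "neighbour_bound > 0"
      using golden_gt_1 by (simp add: neighbour_bound_def add_nonneg_pos)
    have pos: "0 < measure erdos_measure (ball (expansion \<omega>) (1 / golden ^ n))" for n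
      using golden_gt_1 by (intro erdos_measure_ball_pos) simp
    show ?case
    proof (rule order_tendstoI)
      fix d assume "info_rate < d"
      \<comment> \<open>The index is \<open>Suc n\<close> because the lower mass bound needs
        \<open>1 / golden ^ Suc n < 1 / golden ^ n\<close>; the shift leaves the rate
        unchanged.\<close>
      then have "\<forall>\<^sub>F n in sequentially. info (Suc n) \<omega> / real n < d"
        using tendsto_shifted_rate[OF elim(1)] by (intro order_tendstoD)
      then show "\<forall>\<^sub>F n in sequentially. ball_info n (expansion \<omega>) / real n < d"
      proof eventually_elim
        case (elim n)
        have "1 / golden ^ Suc n < 1 / golden ^ n"
          using golden_gt_1 by (intro divide_strict_left_mono power_strict_increasing) auto
        then have "pmass (Suc n) (partial_sum (Suc n) \<omega>) \<le> measure erdos_measure (ball (expansion \<omega>) (1 / golden ^ n))"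
          by (rule pmass_le_erdos_measure_ball)
        then have "ball_info n (expansion \<omega>) \<le> info (Suc n) \<omega>"
          using pmass_pos[of "Suc n" \<omega>] by (simp add: ball_info_def info_def)
        then have "ball_info n (expansion \<omega>) / real n \<le> info (Suc n) \<omega> / real n"
          by (rule divide_right_mono) simp
        with elim show ?case by linarith
      qed
    next
      fix d assume "d < info_rate"
      then have "0 < info_rate - d" by simp
      then obtain j where j: "1 / real (Suc j) < info_rate - d" by (rule nat_approx_posE)
      \<comment> \<open>The bounded number of neighbours contributes only
        \<open>ln neighbour_bound / n\<close>, which vanishes in the limit.\<close>
      have "(\<lambda>n. info_rate - 1 / real (Suc j) - ln neighbour_bound / real n) \<longlonglongrightarrow> info_rate - 1 / real (Suc j) - 0"
        by (intro tendsto_intros lim_const_over_n)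
      then have "\<forall>\<^sub>F n in sequentially. d < info_rate - 1 / real (Suc j) - ln neighbour_bound / real n"
        using j by (intro order_tendstoD) auto
      moreover have "\<forall>\<^sub>F n in sequentially.
          \<forall>u\<in>neighbours n (partial_sum n \<omega>). pmass n u \<le> exp (- (real n * (info_rate - 1 / Suc j)))"
        using elim(2) by blast
      ultimately show "\<forall>\<^sub>F n in sequentially. d < ball_info n (expansion \<omega>) / real n"
        using eventually_gt_at_top[of 0]
      proof eventually_elim
        case (elim n)
        let ?e = "exp (- (real n * (info_rate - 1 / Suc j)))"
        have "measure erdos_measure (ball (expansion \<omega>) (1 / golden ^ n)) \<le>
            (\<Sum>u\<in>neighbours n (partial_sum n \<omega>). pmass n u)"
          by (rule erdos_measure_ball_le)
        also have "\<dots> \<le> real (card (neighbours n (partial_sum n \<omega>))) * ?e"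
          using elim(2) by (intro sum_bounded_above) auto
        also have "\<dots> \<le> neighbour_bound * ?e"
          by (intro mult_right_mono card_neighbours) simp
        finally have "ln (measure erdos_measure (ball (expansion \<omega>) (1 / golden ^ n))) \<le> ln (neighbour_bound * ?e)"
          using pos K by (subst ln_le_cancel_iff) auto
        also have "\<dots> = ln neighbour_bound - real n * (info_rate - 1 / Suc j)"
          using K by (simp add: ln_mult)
        finally have "real n * (info_rate - 1 / Suc j) - ln neighbour_bound \<le> ball_info n (expansion \<omega>)"
          by (simp add: ball_info_def)
        then have "(real n * (info_rate - 1 / Suc j) - ln neighbour_bound) / real n \<le> ball_info n (expansion \<omega>) / real n"
          by (rule divide_right_mono) simp
        moreover have "(real n * (info_rate - 1 / Suc j) - ln neighbour_bound) / real n =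
            info_rate - 1 / Suc j - ln neighbour_bound / real n"
          using elim(3) by (simp add: diff_divide_distrib)
        ultimately show ?case using elim(1) by linarith
      qed
    qed
  qed
qed

section \<open>Measurability and passage to all radii\<close>

text \<open>The pairs at distance below \<open>r\<close> form an open set, measurable for the
  product sigma-algebra by second countability, and its sections are the balls.\<close>

lemma measurable_measure_ball:
  fixes M :: "'a::{metric_space, second_countable_topology} measure"
  assumes "finite_measure M" and [measurable_cong]: "sets M = sets borel"
  shows "(\<lambda>x. measure M (ball x r)) \<in> borel_measurable borel"
proof -
  interpret finite_measure M by fact
  let ?Q = "{p :: 'a \<times> 'a. dist (fst p) (snd p) < r}"
  have "open ?Q" by (intro open_Collect_less continuous_intros)
  then have "?Q \<in> sets (borel \<Otimes>\<^sub>M borel)"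
    unfolding borel_prod by (rule borel_open)
  then have "?Q \<in> sets (borel \<Otimes>\<^sub>M M)"
    using sets_pair_measure_cong[OF refl assms(2)] by blast
  then have "(\<lambda>x. emeasure M (Pair x -` ?Q)) \<in> borel_measurable borel"
    by (rule measurable_emeasure_Pair)
  moreover have "Pair x -` ?Q = ball x r" for x
    by auto
  ultimately show ?thesis by (simp add: measure_def)
qed

lemma measurable_ball_info [measurable]: "ball_info n \<in> borel_measurable borel"
proof -
  interpret prob_space erdos_measure by (rule prob_space_erdos_measure)
  have [measurable]: "(\<lambda>x. measure erdos_measure (ball x (1 / golden ^ n))) \<in> borel_measurable borel"
    by (rule measurable_measure_ball) (simp_all add: finite_measure_axioms)
  show ?thesis unfolding ball_info_def[abs_def] by measurable
qed

text \<open>With countable quantifiers only, the set where a limit holds is visibly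
  measurable.\<close>

lemma tendsto_iff_inverse_Suc:
  fixes a :: "nat \<Rightarrow> 'a::metric_space"
  shows "a \<longlonglongrightarrow> L \<longleftrightarrow> (\<forall>k. \<exists>N. \<forall>n\<ge>N. dist (a n) L < 1 / real (Suc k))"
proof
  assume "a \<longlonglongrightarrow> L"
  then show "\<forall>k. \<exists>N. \<forall>n\<ge>N. dist (a n) L < 1 / real (Suc k)"
    unfolding lim_sequentially by simp
next
  assume *: "\<forall>k. \<exists>N. \<forall>n\<ge>N. dist (a n) L < 1 / real (Suc k)"
  show "a \<longlonglongrightarrow> L"
    unfolding lim_sequentially
  proof (intro allI impI)
    fix e :: real assume "e > 0"
    then obtain k where "1 / real (Suc k) < e" by (rule nat_approx_posE)
    with * show "\<exists>N. \<forall>n\<ge>N. dist (a n) L < e" by (meson less_trans)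
  qed
qed

text \<open>Monotonicity in \<open>r\<close> reduces the limit to the radii \<open>1 / golden ^ n\<close>.\<close>

lemma tendsto_ball_of_tendsto_ball_info:
  assumes pos: "\<And>n. 0 < measure erdos_measure (ball x (1 / golden ^ n))"
    and lim: "(\<lambda>n. ball_info n x / real n) \<longlonglongrightarrow> info_rate"
  shows "((\<lambda>r. ln (measure erdos_measure (ball x r)) / ln r) \<longlongrightarrow> garsia_entropy) (at_right 0)"
proof -
  interpret prob_space erdos_measure by (rule prob_space_erdos_measure)
  have lg: "ln golden > 0" using golden_gt_1 by simp
  \<comment> \<open>For small \<open>r\<close> this index satisfies
    \<open>1 / golden ^ Suc n \<le> r \<le> 1 / golden ^ n\<close>. Accordingly \<open>lower\<close>
    pairs the smaller numerator with the larger denominator, and \<open>upper\<close> does the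
    opposite.\<close>
  define N where "N = (\<lambda>r. nat \<lfloor>- ln r / ln golden\<rfloor>)"
  define lower where "lower = (\<lambda>n. ball_info n x / (real (Suc n) * ln golden))"
  define upper where "upper = (\<lambda>n. ball_info (Suc n) x / (real n * ln golden))"
  have nonneg: "0 \<le> ball_info n x" for n
    using pos[of n] by (simp add: ball_info_def)
  have "filterlim (\<lambda>r. - ln r :: real) at_top (at_right 0)"
    using ln_at_0 by (simp add: filterlim_uminus_at_top)
  then have "filterlim (\<lambda>r. inverse (ln golden) * - ln r :: real) at_top (at_right 0)"
    using lg by (intro filterlim_tendsto_pos_mult_at_top[OF tendsto_const]) auto
  then have "filterlim (\<lambda>r. - ln r / ln golden :: real) at_top (at_right 0)"
    by (simp add: divide_inverse mult.commute)
  then have N: "filterlim N sequentially (at_right 0)"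
    unfolding N_def
    by (intro filterlim_compose[OF filterlim_nat_sequentially] filterlim_compose[OF filterlim_floor_sequentially])
  have "(\<lambda>n. ball_info n x / real n * (real n / real (Suc n)) / ln golden) \<longlonglongrightarrow> info_rate * 1 / ln golden"
    using lg by (intro tendsto_intros lim LIMSEQ_n_over_Suc_n) auto
  moreover have "\<forall>\<^sub>F n in sequentially. ball_info n x / real n * (real n / real (Suc n)) / ln golden = lower n"
    using eventually_gt_at_top[of 0] by eventually_elim (simp add: lower_def)
  ultimately have lower: "lower \<longlonglongrightarrow> garsia_entropy"
    using lg by (simp add: tendsto_cong)
  have "(\<lambda>n. ball_info (Suc n) x / real n / ln golden) \<longlonglongrightarrow> info_rate / ln golden"
    using lg by (intro tendsto_intros tendsto_shifted_rate[OF lim]) auto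
  then have upper: "upper \<longlonglongrightarrow> garsia_entropy"
    using lg by (simp add: upper_def[abs_def])
  \<comment> \<open>Below \<open>1 / golden\<close> the index \<open>N r\<close> is at least 1,
    which keeps the denominator in \<open>upper\<close> positive.\<close>
  have "\<forall>\<^sub>F r in at_right 0. 0 < r \<and> r < 1 / golden"
    using golden_gt_1 by (intro eventually_conj eventually_at_right_less)
      (auto simp: eventually_at_right_field intro!: exI[of _ "1 / golden"])
  then have sandwich: "\<forall>\<^sub>F r in at_right 0.
      lower (N r) \<le> ln (measure erdos_measure (ball x r)) / ln r \<and>
      ln (measure erdos_measure (ball x r)) / ln r \<le> upper (N r)"
  proof eventually_elim
    case (elim r)
    define n where "n = N r"
    define t where "t = - ln r"
    have "ln r < ln (1 / golden)" using elim golden_gt_1 by (subst ln_less_cancel_iff) auto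
    then have t: "t > ln golden" using golden_gt_1 by (simp add: t_def ln_div)
    then have "t / ln golden > 1" using lg by simp
    then have n: "n \<ge> 1" "real n \<le> t / ln golden" "t / ln golden < real (Suc n)"
      unfolding n_def N_def t_def by (auto simp: le_nat_iff) linarith+
    then have nt: "real n * ln golden \<le> t" "t < real (Suc n) * ln golden"
      using lg by (simp_all add: field_simps)
    have ln_pow: "ln (1 / golden ^ k) = - (real k * ln golden)" for k
      using golden_gt_1 by (simp add: ln_div ln_realpow)
    have r_le: "r \<le> 1 / golden ^ n"
    proof -
      have "ln r \<le> ln (1 / golden ^ n)" using nt(1) unfolding ln_pow t_def by simp
      then show ?thesis using elim golden_gt_1 by (subst (asm) ln_le_cancel_iff) auto
    qed
    have r_ge: "1 / golden ^ Suc n \<le> r"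
    proof -
      have "ln (1 / golden ^ Suc n) \<le> ln r" using nt(2) unfolding ln_pow t_def by simp
      then show ?thesis using elim golden_gt_1 by (subst (asm) ln_le_cancel_iff) auto
    qed
    define b where "b = - ln (measure erdos_measure (ball x r))"
    have m1: "measure erdos_measure (ball x (1 / golden ^ Suc n)) \<le> measure erdos_measure (ball x r)"
      using r_ge by (intro finite_measure_mono subset_ball) auto
    have m2: "measure erdos_measure (ball x r) \<le> measure erdos_measure (ball x (1 / golden ^ n))"
      using r_le by (intro finite_measure_mono subset_ball) auto
    have mpos: "0 < measure erdos_measure (ball x r)"
      using m1 pos[of "Suc n"] by linarith
    have b: "ball_info n x \<le> b" "b \<le> ball_info (Suc n) x"
      using m1 m2 mpos pos[of n] pos[of "Suc n"] unfolding b_def ball_info_def by simp_all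
    have "ln (measure erdos_measure (ball x r)) / ln r = b / t"
      by (simp add: b_def t_def)
    moreover have "lower n \<le> b / t"
      unfolding lower_def using b nt nonneg[of n] t lg by (intro frac_le) auto
    moreover have "b / t \<le> upper n"
      unfolding upper_def using b nt nonneg[of "Suc n"] n lg by (intro frac_le) auto
    ultimately show ?case by (simp add: n_def)
  qed
  show ?thesis
  proof (rule tendsto_sandwich)
    show "((\<lambda>r. lower (N r)) \<longlongrightarrow> garsia_entropy) (at_right 0)"
      by (rule filterlim_compose[OF lower N])
    show "((\<lambda>r. upper (N r)) \<longlongrightarrow> garsia_entropy) (at_right 0)"
      by (rule filterlim_compose[OF upper N])
  qed (use sandwich in \<open>auto elim: eventually_mono\<close>)
qed

theorem theorem3p7:
  shows "has_pointwise_dimension erdos_measure garsia_entropy"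
proof -
  interpret prob_space erdos_measure by (rule prob_space_erdos_measure)
  \<comment> \<open>Only countably many radii enter \<open>Q\<close>, so it defines a Borel set and
    the almost sure statement about \<open>expansion\<close> can be transferred to its
    distribution.\<close>
  define Q where "Q = (\<lambda>x. (\<forall>n. 0 < measure erdos_measure (ball x (1 / golden ^ n))) \<and>
      (\<lambda>n. ball_info n x / real n) \<longlonglongrightarrow> info_rate)"
  have [measurable]: "(\<lambda>x. measure erdos_measure (ball x r)) \<in> borel_measurable borel" for r
    by (rule measurable_measure_ball) (simp_all add: finite_measure_axioms)
  have "{x \<in> space borel. Q x} \<in> sets borel"
    unfolding Q_def tendsto_iff_inverse_Suc by measurable
  moreover have "AE \<omega> in coin_space. Q (expansion \<omega>)"
    using AE_ball_info
    by eventually_elim (use erdos_measure_ball_pos golden_gt_1 in \<open>simp add: Q_def\<close>)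
  ultimately have "AE x in erdos_measure. Q x"
    unfolding erdos_measure_eq_distr by (subst AE_distr_iff) auto
  then have "AE x in erdos_measure. (\<forall>r>0. measure erdos_measure (ball x r) > 0) \<and>
      ((\<lambda>r. ln (measure erdos_measure (ball x r)) / ln r) \<longlongrightarrow> garsia_entropy) (at_right 0)"
  proof eventually_elim
    case (elim x)
    have "0 < measure erdos_measure (ball x r)" if r: "r > 0" for r
    proof -
      obtain n where "1 / golden ^ n < r"
        using ex_inverse_golden_power_less[OF r] by blast
      then have "measure erdos_measure (ball x (1 / golden ^ n)) \<le> measure erdos_measure (ball x r)"
        by (intro finite_measure_mono subset_ball) auto
      then show ?thesis using elim unfolding Q_def by (meson less_le_trans)
    qed
    moreover have "((\<lambda>r. ln (measure erdos_measure (ball x r)) / ln r) \<longlongrightarrow> garsia_entropy) (at_right 0)"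
      using elim unfolding Q_def by (intro tendsto_ball_of_tendsto_ball_info) auto
    ultimately show ?case by blast
  qed
  then show ?thesis
    by (simp add: has_pointwise_dimension_def prob_space_erdos_measure)
qed

end
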